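(* The forgetful functor from $\mathbf{FCov}_i$ (inductively generated formal covers) to $\mathbf{uCBCov}_i$ (inductively generated unital convergent covers) has a right adjoint $L:\mathbf{uCBCov}_i\to\mathbf{FCov}_i$ that is surjective on objects.
   Context: A basic cover $(S,\lhd)$ on a set $S$ is a relation $\lhd$ between elements and subsets of $S$ such that $a\in U$ implies $a\lhd U$, and $a\lhd U$, $U\lhd V$ imply $a\lhd V$, where $U\lhd V$ means $b\lhd V$ for all $b\in U$. Put $\mathcal A U=\{a\in S\mid a\lhd U\}$; $U=_{\mathcal A}V$ means $\mathcal A U=\mathcal A V$. $Sat(\mathcal A)=\{U\subseteq S\mid U=\mathcal A U\}$ has joins $\bigvee^{\mathcal A}_i\mathcal A U_i=\mathcal A(\bigcup_iU_i)$. Elements are identified with singletons; $a\circ b=\{a\}\circ\{b\}$, etc. For a relation $r$ between $S$ and $T$ and $V\subseteq T$, $r^-V=\{a\in S\mid\exists b\in V,\ a\,r\,b\}$. A basic cover map $r:(S,\lhd_S)\to(T,\lhd_T)$ is a relation between $S$ and $T$ such that $b\lhd_TV$ implies $r^-b\lhd_Sr^-V$; two are equal if $r_1^-b=_{\mathcal A_S}r_2^-b$ for all $b\in T$; composition is relational composition. An axiom-set $(I,C)$ on $S$: sets $I(a)$ ($a\in S$) and subsets $C(a,i)\subseteq S$ ($i\in I(a)$). It generates the least basic cover with $a\lhd C(a,i)$ for all $a,i$ (inductively defined by: $a\in U$ implies $a\lhd U$; $i\in I(a)$ and $C(a,i)\lhd U$ imply $a\lhd U$). A convergent cover is $(S,\lhd,\circ)$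 where $\lhd$ is a basic cover on $S$ and $\circ$ is a binary operation on $\mathcal P(S)$ such that: $U_1\lhd V_1$ and $U_2\lhd V_2$ imply $U_1\circ U_2\lhd V_1\circ V_2$; $(U\circ V)\circ W\lhd U\circ(V\circ W)$; $U\circ V\lhd V\circ U$; and the operation $\mathcal A U\circ^{\mathcal A}\mathcal A V=\mathcal A(U\circ V)$ on $Sat(\mathcal A)$ distributes over arbitrary joins. It is unital if there is $I_S\subseteq S$ with $a\circ I_S=_{\mathcal A}a=_{\mathcal A}I_S\circ a$ for all $a\in S$. A unital convergent cover map is a basic cover map $r:\mathcal S\to\mathcal T$ with $r^-(b_1\circ_Tb_2)=_{\mathcal A_S}(r^-b_1)\circ_S(r^-b_2)$ for all $b_1,b_2\in T$ and $r^-I_T=_{\mathcal A_S}I_S$; equality is equality of basic cover maps. A formal cover is a convergent cover with $\mathcal A(U\circ V)=\mathcal A U\cap\mathcal A V$ for all $U,V\subseteq S$; then $S$ is a unit, and formal cover maps are the unital convergent cover maps between formal covers. Inductive generation: given an axiom-set $(I,C)$ on $S$ and a map $\delta:S\times S\to\mathcal P(S)$, put $U\circ V=\bigcup\{\delta(a,b)\mid a\in U,b\in V\}$. Let $(J,D)$ be $(I,C)$ plus the axioms $a\lhd c\circ b$ for $a\in b\circ c$ and $a\lhd b\circ(c\circ d)$ for $a\in(b\circ c)\circ d$; let $(J',D')$ be $(J,D)$ plus the axioms $a\lhd D(b,j)\circ c$ for $a\in b\circ c$, $j\in J(b)$; let $(J'',D'')$ be $(J',D')$ plus the axioms $a\lhd\{c\}$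 for $a\in b\circ c$ and $a\lhd a\circ a$. A convergent cover (respectively formal cover) $(S,\lhd,\circ)$ is inductively generated if for some $(I,C)$ and $\delta$ it has this $\circ$ and $\lhd$ is the basic cover generated by $(J',D')$ (respectively by $(J'',D'')$). $\mathbf{uCBCov}_i$ is the category of inductively generated convergent covers that are unital, with unital convergent cover maps; $\mathbf{FCov}_i$ is the category of inductively generated formal covers and formal cover maps. *)

theory Defs
  imports "HOL-Library.FuncSet"
begin

section \<open>Basic covers and convergent covers\<close>

text \<open>
  A cover lives on a subset of an ambient type. The relation and the operation are normalised
  outside the carrier (the relation is false, the operation is undefined there), so that
  HOL equality of records is equality of structures.
\<close>

record 'a basic_cover_str =
  pts :: "'a set"
  cov :: "'a \<Rightarrow> 'a set \<Rightarrow> bool" (infix "\<lhd>\<index>" 50)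

record 'a conv_cover_str = "'a basic_cover_str" +
  conv :: "'a set \<Rightarrow> 'a set \<Rightarrow> 'a set" (infixl "\<odot>\<index>" 70)

definition covers :: "('a, 'z) basic_cover_str_scheme \<Rightarrow> 'a set \<Rightarrow> 'a set \<Rightarrow> bool"
    (infix "\<lhd>\<lhd>\<index>" 50) where
  "U \<lhd>\<lhd>\<^bsub>X\<^esub> V \<longleftrightarrow> (\<forall>b\<in>U. b \<lhd>\<^bsub>X\<^esub> V)"

definition basic_cover :: "('a, 'z) basic_cover_str_scheme \<Rightarrow> bool" where
  "basic_cover X \<longleftrightarrow>
     (\<forall>a U. a \<lhd>\<^bsub>X\<^esub> U \<longrightarrow> a \<in> pts X \<and> U \<subseteq> pts X) \<and>
     (\<forall>U a. U \<subseteq> pts X \<longrightarrow> a \<in> U \<longrightarrow> a \<lhd>\<^bsub>X\<^esub> U) \<and>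
     (\<forall>a U V. V \<subseteq> pts X \<longrightarrow> a \<lhd>\<^bsub>X\<^esub> U \<longrightarrow> U \<lhd>\<lhd>\<^bsub>X\<^esub> V \<longrightarrow> a \<lhd>\<^bsub>X\<^esub> V)"

definition saturation :: "('a, 'z) basic_cover_str_scheme \<Rightarrow> 'a set \<Rightarrow> 'a set" where
  "saturation X U = {a \<in> pts X. a \<lhd>\<^bsub>X\<^esub> U}"

definition Sat :: "('a, 'z) basic_cover_str_scheme \<Rightarrow> 'a set set" where
  "Sat X = {U. U \<subseteq> pts X \<and> U = saturation X U}"

definition Sat_join :: "('a, 'z) basic_cover_str_scheme \<Rightarrow> 'a set set \<Rightarrow> 'a set" where
  "Sat_join X \<W> = saturation X (\<Union>\<W>)"

text \<open>
  Intended for saturated arguments: if \<open>P\<close>, \<open>Q\<close> are the saturations of \<open>U\<close>, \<open>V\<close> in a convergent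
  cover, then stability makes this the saturation of \<open>U \<odot> V\<close>.
\<close>

definition Sat_conv :: "('a, 'z) conv_cover_str_scheme \<Rightarrow> 'a set \<Rightarrow> 'a set \<Rightarrow> 'a set" where
  "Sat_conv X P Q = saturation X (P \<odot>\<^bsub>X\<^esub> Q)"

definition convergent_cover :: "('a, 'z) conv_cover_str_scheme \<Rightarrow> bool" where
  "convergent_cover X \<longleftrightarrow>
     basic_cover X \<and>
     case_prod (conv X) \<in> Pow (pts X) \<times> Pow (pts X) \<rightarrow>\<^sub>E Pow (pts X) \<and>
     (\<forall>U1\<in>Pow (pts X). \<forall>U2\<in>Pow (pts X). \<forall>V1\<in>Pow (pts X). \<forall>V2\<in>Pow (pts X).
        U1 \<lhd>\<lhd>\<^bsub>X\<^esub> V1 \<longrightarrow> U2 \<lhd>\<lhd>\<^bsub>X\<^esub> V2 \<longrightarrow> U1 \<odot>\<^bsub>X\<^esub> U2 \<lhd>\<lhd>\<^bsub>X\<^esub> V1 \<odot>\<^bsub>X\<^esub> V2) \<and>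
     (\<forall>U\<in>Pow (pts X). \<forall>V\<in>Pow (pts X). \<forall>W\<in>Pow (pts X).
        (U \<odot>\<^bsub>X\<^esub> V) \<odot>\<^bsub>X\<^esub> W \<lhd>\<lhd>\<^bsub>X\<^esub> U \<odot>\<^bsub>X\<^esub> (V \<odot>\<^bsub>X\<^esub> W)) \<and>
     (\<forall>U\<in>Pow (pts X). \<forall>V\<in>Pow (pts X). U \<odot>\<^bsub>X\<^esub> V \<lhd>\<lhd>\<^bsub>X\<^esub> V \<odot>\<^bsub>X\<^esub> U) \<and>
     (\<forall>P\<in>Sat X. \<forall>\<Q>\<subseteq>Sat X.
        Sat_conv X P (Sat_join X \<Q>) = Sat_join X ((\<lambda>Q. Sat_conv X P Q) ` \<Q>) \<and>
        Sat_conv X (Sat_join X \<Q>) P = Sat_join X ((\<lambda>Q. Sat_conv X Q P) ` \<Q>))"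

definition is_unit :: "('a, 'z) conv_cover_str_scheme \<Rightarrow> 'a set \<Rightarrow> bool" where
  "is_unit X E \<longleftrightarrow> E \<subseteq> pts X \<and>
     (\<forall>a\<in>pts X. saturation X ({a} \<odot>\<^bsub>X\<^esub> E) = saturation X {a} \<and>
                saturation X {a} = saturation X (E \<odot>\<^bsub>X\<^esub> {a}))"

definition unital :: "('a, 'z) conv_cover_str_scheme \<Rightarrow> bool" where
  "unital X \<longleftrightarrow> (\<exists>E. is_unit X E)"

definition formal_cover :: "('a, 'z) conv_cover_str_scheme \<Rightarrow> bool" where
  "formal_cover X \<longleftrightarrow> convergent_cover X \<and>
     (\<forall>U\<in>Pow (pts X). \<forall>V\<in>Pow (pts X).
        saturation X (U \<odot>\<^bsub>X\<^esub> V) = saturation X U \<inter> saturation X V)"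

section \<open>Maps\<close>

text \<open>The inverse image of \<open>V\<close> along \<open>r\<close> is the library's \<open>r\<inverse> `` V\<close>.\<close>

definition basic_cover_map ::
    "('a, 'y) basic_cover_str_scheme \<Rightarrow> ('b, 'z) basic_cover_str_scheme \<Rightarrow> ('a \<times> 'b) set \<Rightarrow> bool" where
  "basic_cover_map X Y r \<longleftrightarrow> r \<subseteq> pts X \<times> pts Y \<and>
     (\<forall>b V. b \<lhd>\<^bsub>Y\<^esub> V \<longrightarrow> r\<inverse> `` {b} \<lhd>\<lhd>\<^bsub>X\<^esub> r\<inverse> `` V)"

text \<open>
  Units are unique only up to equality of saturations, and a cover map respects that
  equality, so the condition on units does not depend on the choice of the units.
\<close>

definition unital_conv_map ::
    "('a, 'y) conv_cover_str_scheme \<Rightarrow> ('b, 'z) conv_cover_str_scheme \<Rightarrow> ('a \<times> 'b) set \<Rightarrow> bool" where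
  "unital_conv_map X Y r \<longleftrightarrow> basic_cover_map X Y r \<and>
     (\<forall>b\<in>pts Y. \<forall>c\<in>pts Y.
        saturation X (r\<inverse> `` ({b} \<odot>\<^bsub>Y\<^esub> {c})) =
        saturation X ((r\<inverse> `` {b}) \<odot>\<^bsub>X\<^esub> (r\<inverse> `` {c}))) \<and>
     (\<forall>E E'. is_unit X E \<longrightarrow> is_unit Y E' \<longrightarrow>
        saturation X (r\<inverse> `` E') = saturation X E)"

definition map_eq ::
    "('a, 'y) conv_cover_str_scheme \<Rightarrow> ('b, 'z) conv_cover_str_scheme \<Rightarrow> (('a \<times> 'b) set) rel" where
  "map_eq X Y = {(r, s). unital_conv_map X Y r \<and> unital_conv_map X Y s \<and>
     (\<forall>b\<in>pts Y. saturation X (r\<inverse> `` {b}) = saturation X (s\<inverse> `` {b}))}"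

section \<open>Inductive generation\<close>

record ('a, 'i) axiom_set =
  ax_index :: "'a \<Rightarrow> 'i set"
  ax_set :: "'a \<Rightarrow> 'i \<Rightarrow> 'a set"

definition axiom_set_on :: "'a set \<Rightarrow> ('a, 'i) axiom_set \<Rightarrow> bool" where
  "axiom_set_on S A \<longleftrightarrow> (\<forall>a\<in>S. \<forall>i\<in>ax_index A a. ax_set A a i \<subseteq> S)"

inductive generated :: "'a set \<Rightarrow> ('a, 'i) axiom_set \<Rightarrow> 'a \<Rightarrow> 'a set \<Rightarrow> bool"
  for S :: "'a set" and A :: "('a, 'i) axiom_set" where
  refl: "a \<in> U \<Longrightarrow> U \<subseteq> S \<Longrightarrow> generated S A a U"
| infinity: "a \<in> S \<Longrightarrow> U \<subseteq> S \<Longrightarrow> i \<in> ax_index A a \<Longrightarrow>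
    (\<And>b. b \<in> ax_set A a i \<Longrightarrow> generated S A b U) \<Longrightarrow> generated S A a U"

definition conv_of :: "'a set \<Rightarrow> ('a \<times> 'a \<Rightarrow> 'a set) \<Rightarrow> 'a set \<Rightarrow> 'a set \<Rightarrow> 'a set" where
  "conv_of S \<delta> U V =
     (if U \<subseteq> S \<and> V \<subseteq> S then \<Union>{\<delta> (a, b) |a b. a \<in> U \<and> b \<in> V} else undefined)"

text \<open>
  The extensions \<open>J\<close>, \<open>J'\<close>, \<open>J''\<close> of an axiom-set. In each datatype the first constructor
  embeds the indices of the axiom-set being extended.
\<close>

datatype ('a, 'i) J_index = Given 'i | Comm 'a 'a | Assoc 'a 'a 'a

definition J_axioms ::
    "'a set \<Rightarrow> ('a \<times> 'a \<Rightarrow> 'a set) \<Rightarrow> ('a, 'i) axiom_set \<Rightarrow> ('a, ('a, 'i) J_index) axiom_set" where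
  "J_axioms S \<delta> A = (let m = conv_of S \<delta> in
    \<lparr>ax_index = (\<lambda>a. Given ` ax_index A a
        \<union> {Comm b c |b c. b \<in> S \<and> c \<in> S \<and> a \<in> m {b} {c}}
        \<union> {Assoc b c d |b c d. b \<in> S \<and> c \<in> S \<and> d \<in> S \<and> a \<in> m (m {b} {c}) {d}}),
     ax_set = (\<lambda>a j. case j of
        Given i \<Rightarrow> ax_set A a i
      | Comm b c \<Rightarrow> m {c} {b}
      | Assoc b c d \<Rightarrow> m {b} (m {c} {d}))\<rparr>)"

datatype ('a, 'j) J'_index = Unlocalized 'j | Localized 'a 'j 'a

definition J'_axioms ::
    "'a set \<Rightarrow> ('a \<times> 'a \<Rightarrow> 'a set) \<Rightarrow> ('a, 'i) axiom_set \<Rightarrow>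
      ('a, ('a, ('a, 'i) J_index) J'_index) axiom_set" where
  "J'_axioms S \<delta> A = (let m = conv_of S \<delta>; B = J_axioms S \<delta> A in
    \<lparr>ax_index = (\<lambda>a. Unlocalized ` ax_index B a
        \<union> {Localized b j c |b j c. b \<in> S \<and> c \<in> S \<and> j \<in> ax_index B b \<and> a \<in> m {b} {c}}),
     ax_set = (\<lambda>a k. case k of
        Unlocalized j \<Rightarrow> ax_set B a j
      | Localized b j c \<Rightarrow> m (ax_set B b j) {c})\<rparr>)"

datatype ('a, 'k) J''_index = Convergent 'k | Weakening 'a 'a | Contraction

definition J''_axioms ::
    "'a set \<Rightarrow> ('a \<times> 'a \<Rightarrow> 'a set) \<Rightarrow> ('a, 'i) axiom_set \<Rightarrow>
      ('a, ('a, ('a, ('a, 'i) J_index) J'_index) J''_index) axiom_set" where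
  "J''_axioms S \<delta> A = (let m = conv_of S \<delta>; B = J'_axioms S \<delta> A in
    \<lparr>ax_index = (\<lambda>a. Convergent ` ax_index B a
        \<union> {Weakening b c |b c. b \<in> S \<and> c \<in> S \<and> a \<in> m {b} {c}}
        \<union> {Contraction}),
     ax_set = (\<lambda>a l. case l of
        Convergent k \<Rightarrow> ax_set B a k
      | Weakening b c \<Rightarrow> {c}
      | Contraction \<Rightarrow> m {a} {a})\<rparr>)"

text \<open>
  HOL cannot quantify existentially over the type of indices. Indices of type \<open>'a set\<close> suffice:
  the generated cover only depends on the families \<open>{ax_set A a i |i. i \<in> ax_index A a}\<close>, and
  these are sets of subsets of \<open>'a\<close>, which can index themselves.
\<close>

definition ind_gen_convergent :: "'a conv_cover_str \<Rightarrow> bool" where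
  "ind_gen_convergent X \<longleftrightarrow> convergent_cover X \<and>
     (\<exists>(A :: ('a, 'a set) axiom_set) \<delta>.
        axiom_set_on (pts X) A \<and> \<delta> \<in> pts X \<times> pts X \<rightarrow> Pow (pts X) \<and>
        conv X = conv_of (pts X) \<delta> \<and>
        cov X = generated (pts X) (J'_axioms (pts X) \<delta> A))"

definition ind_gen_formal :: "'a conv_cover_str \<Rightarrow> bool" where
  "ind_gen_formal X \<longleftrightarrow> formal_cover X \<and>
     (\<exists>(A :: ('a, 'a set) axiom_set) \<delta>.
        axiom_set_on (pts X) A \<and> \<delta> \<in> pts X \<times> pts X \<rightarrow> Pow (pts X) \<and>
        conv X = conv_of (pts X) \<delta> \<and>
        cov X = generated (pts X) (J''_axioms (pts X) \<delta> A))"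

section \<open>Categories, functors, adjunctions\<close>

text \<open>
  Hom-sets are indexed by their endpoints and need not be disjoint, so composition takes
  the three objects as arguments: \<open>cmp C X Y Z g f\<close> is \<open>g \<circ> f\<close> for \<open>f : X \<rightarrow> Y\<close>, \<open>g : Y \<rightarrow> Z\<close>.
\<close>

record ('o, 'm) cat =
  Ob :: "'o set"
  Hom :: "'o \<Rightarrow> 'o \<Rightarrow> 'm set"
  idt :: "'o \<Rightarrow> 'm"
  cmp :: "'o \<Rightarrow> 'o \<Rightarrow> 'o \<Rightarrow> 'm \<Rightarrow> 'm \<Rightarrow> 'm"

locale category =
  fixes C :: "('o, 'm) cat"
  assumes idt_in_Hom: "X \<in> Ob C \<Longrightarrow> idt C X \<in> Hom C X X"
    and cmp_in_Hom: "\<lbrakk>X \<in> Ob C; Y \<in> Ob C; Z \<in> Ob C; f \<in> Hom C X Y; g \<in> Hom C Y Z\<rbrakk>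
      \<Longrightarrow> cmp C X Y Z g f \<in> Hom C X Z"
    and cmp_idt_right: "\<lbrakk>X \<in> Ob C; Y \<in> Ob C; f \<in> Hom C X Y\<rbrakk> \<Longrightarrow> cmp C X X Y f (idt C X) = f"
    and cmp_idt_left: "\<lbrakk>X \<in> Ob C; Y \<in> Ob C; f \<in> Hom C X Y\<rbrakk> \<Longrightarrow> cmp C X Y Y (idt C Y) f = f"
    and cmp_assoc: "\<lbrakk>W \<in> Ob C; X \<in> Ob C; Y \<in> Ob C; Z \<in> Ob C;
        f \<in> Hom C W X; g \<in> Hom C X Y; h \<in> Hom C Y Z\<rbrakk>
      \<Longrightarrow> cmp C W X Z (cmp C X Y Z h g) f = cmp C W Y Z h (cmp C W X Y g f)"

record ('o1, 'm1, 'o2, 'm2) functor_str =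
  on_ob :: "'o1 \<Rightarrow> 'o2"
  on_hom :: "'o1 \<Rightarrow> 'o1 \<Rightarrow> 'm1 \<Rightarrow> 'm2"

locale is_functor = source: category C + target: category D
  for C :: "('o1, 'm1) cat" and D :: "('o2, 'm2) cat" +
  fixes F :: "('o1, 'm1, 'o2, 'm2) functor_str"
  assumes on_ob_in_Ob: "X \<in> Ob C \<Longrightarrow> on_ob F X \<in> Ob D"
    and on_hom_in_Hom: "\<lbrakk>X \<in> Ob C; Y \<in> Ob C; f \<in> Hom C X Y\<rbrakk>
      \<Longrightarrow> on_hom F X Y f \<in> Hom D (on_ob F X) (on_ob F Y)"
    and on_hom_idt: "X \<in> Ob C \<Longrightarrow> on_hom F X X (idt C X) = idt D (on_ob F X)"
    and on_hom_cmp: "\<lbrakk>X \<in> Ob C; Y \<in> Ob C; Z \<in> Ob C; f \<in> Hom C X Y; g \<in> Hom C Y Z\<rbrakk>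
      \<Longrightarrow> on_hom F X Z (cmp C X Y Z g f) =
          cmp D (on_ob F X) (on_ob F Y) (on_ob F Z) (on_hom F Y Z g) (on_hom F X Y f)"

locale adjunction = left: is_functor C D F + right: is_functor D C G
  for C :: "('o1, 'm1) cat" and D :: "('o2, 'm2) cat"
    and F :: "('o1, 'm1, 'o2, 'm2) functor_str" and G :: "('o2, 'm2, 'o1, 'm1) functor_str" +
  fixes \<phi> :: "'o1 \<Rightarrow> 'o2 \<Rightarrow> 'm2 \<Rightarrow> 'm1"
  assumes transpose_bij: "\<lbrakk>X \<in> Ob C; Y \<in> Ob D\<rbrakk>
      \<Longrightarrow> bij_betw (\<phi> X Y) (Hom D (on_ob F X) Y) (Hom C X (on_ob G Y))"
    and transpose_natural: "\<lbrakk>X \<in> Ob C; X' \<in> Ob C; Y \<in> Ob D; Y' \<in> Ob D;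
        f \<in> Hom C X' X; h \<in> Hom D (on_ob F X) Y; k \<in> Hom D Y Y'\<rbrakk>
      \<Longrightarrow> \<phi> X' Y' (cmp D (on_ob F X') Y Y' k (cmp D (on_ob F X') (on_ob F X) Y h (on_hom F X' X f)))
        = cmp C X' (on_ob G Y) (on_ob G Y') (on_hom G Y Y' k)
            (cmp C X' X (on_ob G Y) (\<phi> X Y h) f)"

definition is_right_adjoint ::
    "('o1, 'm1) cat \<Rightarrow> ('o2, 'm2) cat \<Rightarrow> ('o1, 'm1, 'o2, 'm2) functor_str \<Rightarrow>
      ('o2, 'm2, 'o1, 'm1) functor_str \<Rightarrow> bool" where
  "is_right_adjoint C D F G \<longleftrightarrow> (\<exists>\<phi>. adjunction C D F G \<phi>)"

section \<open>The two categories of covers\<close>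

text \<open>
  Morphisms are the classes of maps under \<^const>\<open>map_eq\<close>. The objects are the covers whose
  carrier is a subset of the type \<open>'a\<close>, which plays the role of the universe of sets.
\<close>

definition cover_category :: "'a conv_cover_str set \<Rightarrow> ('a conv_cover_str, 'a rel set) cat" where
  "cover_category \<O> =
    \<lparr>Ob = \<O>,
     Hom = (\<lambda>X Y. {r. unital_conv_map X Y r} // map_eq X Y),
     idt = (\<lambda>X. map_eq X X `` {Id_on (pts X)}),
     cmp = (\<lambda>X Y Z Q P. map_eq X Z `` {r O s |r s. r \<in> P \<and> s \<in> Q})\<rparr>"

definition uCBCov :: "('a conv_cover_str, 'a rel set) cat" where
  "uCBCov = cover_category {X. ind_gen_convergent X \<and> unital X}"

definition FCov :: "('a conv_cover_str, 'a rel set) cat" where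
  "FCov = cover_category {X. ind_gen_formal X}"

definition forgetful ::
    "('a conv_cover_str, 'a rel set, 'a conv_cover_str, 'a rel set) functor_str" where
  "forgetful = \<lparr>on_ob = (\<lambda>X. X), on_hom = (\<lambda>X Y f. f)\<rparr>"

end

theory Submission
  imports Defs
begin

text \<open>
  In the language of quantales, the saturated subsets of a unital convergent cover form a
  commutative unital quantale, those of a formal cover form a frame, and a cover map is a
  homomorphism in the opposite direction. The right adjoint sends a cover to the one presenting
  the frame reflection of its quantale: the points and the operation stay the same, and the cover
  relation is enlarged to the least one containing the given relation and satisfying weakening
  (\<open>{b} \<odot> {c}\<close> is covered by \<open>c\<close>) and contraction (\<open>a\<close> is covered by \<open>{a} \<odot> {a}\<close>). The result is
  called \<open>formalize Y\<close> below.

  Three facts carry the proof.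

  \<^item> Inductive generation amounts to the operation being determined by its values on pairs of
    points: given this, all the covers that hold can be taken as axioms, and the axioms which the
    construction adds are sound anyway (\<open>ind_gen_convergent_iff\<close>, \<open>ind_gen_formal_iff\<close>). Hence
    every inductively generated formal cover is an inductively generated unital convergent
    cover, and the forgetful functor is the inclusion of a full subcategory.

  \<^item> The enlarged relation is still stable under the operation, so that \<open>formalize Y\<close> is a formal
    cover (\<open>formal_cover_formalize\<close>). The critical case is stability for the contraction axiom.

  \<^item> If \<open>X\<close> is formal, then weakening and contraction hold in \<open>X\<close>, so inverse image along any map
    \<open>X \<rightarrow> Y\<close> respects the enlarged relation. A relation is therefore a map \<open>X \<rightarrow> Y\<close> if and only if it
    is a map \<open>X \<rightarrow> formalize Y\<close> (\<open>unital_conv_map_formalize_iff\<close>). Equality of maps only refers to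
    the cover of the source, so the two hom-sets are literally the same set of classes, and the
    transposition of the adjunction is the identity function.

  Surjectivity on objects follows because a formal cover is left unchanged by \<open>formalize\<close>.
\<close>

section \<open>Basic covers\<close>

lemma cov_pts:
  assumes "basic_cover X" "a \<lhd>\<^bsub>X\<^esub> U"
  shows "a \<in> pts X" "U \<subseteq> pts X"
  using assms(1)[unfolded basic_cover_def, THEN conjunct1, rule_format, OF assms(2)] by simp_all

lemma cov_refl:
  assumes "basic_cover X" "U \<subseteq> pts X" "a \<in> U"
  shows "a \<lhd>\<^bsub>X\<^esub> U"
  using assms(1)[unfolded basic_cover_def, THEN conjunct2, THEN conjunct1, rule_format, OF assms(2-)] .

lemma cov_trans:
  assumes "basic_cover X" "V \<subseteq> pts X" "a \<lhd>\<^bsub>X\<^esub> U" "U \<lhd>\<lhd>\<^bsub>X\<^esub> V"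
  shows "a \<lhd>\<^bsub>X\<^esub> V"
  using assms(1)[unfolded basic_cover_def, THEN conjunct2, THEN conjunct2, rule_format, OF assms(2-)] .

lemma coversI: "(\<And>a. a \<in> U \<Longrightarrow> a \<lhd>\<^bsub>X\<^esub> V) \<Longrightarrow> U \<lhd>\<lhd>\<^bsub>X\<^esub> V"
  by (simp add: covers_def)

lemma coversD: "U \<lhd>\<lhd>\<^bsub>X\<^esub> V \<Longrightarrow> a \<in> U \<Longrightarrow> a \<lhd>\<^bsub>X\<^esub> V"
  by (simp add: covers_def)

lemma covers_trans:
  "basic_cover X \<Longrightarrow> W \<subseteq> pts X \<Longrightarrow> U \<lhd>\<lhd>\<^bsub>X\<^esub> V \<Longrightarrow> V \<lhd>\<lhd>\<^bsub>X\<^esub> W \<Longrightarrow> U \<lhd>\<lhd>\<^bsub>X\<^esub> W"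
  by (rule coversI) (rule cov_trans, auto dest: coversD)

lemma covers_subset: "basic_cover X \<Longrightarrow> V \<subseteq> pts X \<Longrightarrow> U \<subseteq> V \<Longrightarrow> U \<lhd>\<lhd>\<^bsub>X\<^esub> V"
  by (rule coversI) (rule cov_refl, auto)

lemma saturation_subset: "saturation X U \<subseteq> pts X"
  by (auto simp: saturation_def)

lemma saturation_eq_iff:
  assumes "basic_cover X" "U \<subseteq> pts X" "V \<subseteq> pts X"
  shows "saturation X U = saturation X V \<longleftrightarrow> U \<lhd>\<lhd>\<^bsub>X\<^esub> V \<and> V \<lhd>\<lhd>\<^bsub>X\<^esub> U"
proof
  assume eq: "saturation X U = saturation X V"
  have "U \<subseteq> saturation X U" "V \<subseteq> saturation X V"
    using assms cov_refl[OF assms(1)] by (auto simp: saturation_def)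
  then show "U \<lhd>\<lhd>\<^bsub>X\<^esub> V \<and> V \<lhd>\<lhd>\<^bsub>X\<^esub> U"
    using eq unfolding covers_def saturation_def by blast
next
  assume eq: "U \<lhd>\<lhd>\<^bsub>X\<^esub> V \<and> V \<lhd>\<lhd>\<^bsub>X\<^esub> U"
  then have "a \<lhd>\<^bsub>X\<^esub> U \<longleftrightarrow> a \<lhd>\<^bsub>X\<^esub> V" for a
    using cov_trans[OF assms(1,2), of a V] cov_trans[OF assms(1,3), of a U] by blast
  then show "saturation X U = saturation X V"
    by (simp add: saturation_def)
qed

section \<open>Convergent covers with a pointwise operation\<close>

text \<open>The part of inductive generation that concerns the operation alone.\<close>

definition pointwise :: "'a conv_cover_str \<Rightarrow> bool" where
  "pointwise X \<longleftrightarrow> (\<exists>\<delta> \<in> pts X \<times> pts X \<rightarrow> Pow (pts X). conv X = conv_of (pts X) \<delta>)"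

lemma pointwise_conv_subset:
  assumes "pointwise X" "U \<subseteq> pts X" "V \<subseteq> pts X"
  shows "U \<odot>\<^bsub>X\<^esub> V \<subseteq> pts X"
proof -
  obtain \<delta> where "\<delta> \<in> pts X \<times> pts X \<rightarrow> Pow (pts X)" "conv X = conv_of (pts X) \<delta>"
    using assms(1) by (auto simp: pointwise_def)
  moreover from this have "\<delta> (a, b) \<subseteq> pts X" if "a \<in> U" "b \<in> V" for a b
    using that assms(2,3) by (auto dest!: funcset_mem[where x = "(a, b)"])
  ultimately show ?thesis using assms(2,3) by (auto simp: conv_of_def)
qed

lemma pointwise_conv_iff:
  assumes "pointwise X" "U \<subseteq> pts X" "V \<subseteq> pts X"
  shows "x \<in> U \<odot>\<^bsub>X\<^esub> V \<longleftrightarrow> (\<exists>a\<in>U. \<exists>b\<in>V. x \<in> {a} \<odot>\<^bsub>X\<^esub> {b})"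
proof -
  obtain \<delta> where "conv X = conv_of (pts X) \<delta>"
    using assms(1) by (auto simp: pointwise_def)
  then have "U \<odot>\<^bsub>X\<^esub> V = (\<Union>a\<in>U. \<Union>b\<in>V. \<delta> (a, b))"
    and "\<And>a b. a \<in> U \<Longrightarrow> b \<in> V \<Longrightarrow> {a} \<odot>\<^bsub>X\<^esub> {b} = \<delta> (a, b)"
    using assms(2,3) by (auto simp: conv_of_def)
  then show ?thesis by simp
qed

lemma pointwise_conv_mono:
  assumes "pointwise X" "U \<subseteq> U'" "V \<subseteq> V'" "U' \<subseteq> pts X" "V' \<subseteq> pts X"
  shows "U \<odot>\<^bsub>X\<^esub> V \<subseteq> U' \<odot>\<^bsub>X\<^esub> V'"
proof
  have sub: "U \<subseteq> pts X" "V \<subseteq> pts X" using assms by auto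
  fix x assume "x \<in> U \<odot>\<^bsub>X\<^esub> V"
  then have "\<exists>a\<in>U. \<exists>b\<in>V. x \<in> {a} \<odot>\<^bsub>X\<^esub> {b}"
    by (simp only: pointwise_conv_iff[OF assms(1) sub])
  then have "\<exists>a\<in>U'. \<exists>b\<in>V'. x \<in> {a} \<odot>\<^bsub>X\<^esub> {b}"
    using assms(2,3) by blast
  then show "x \<in> U' \<odot>\<^bsub>X\<^esub> V'"
    by (simp only: pointwise_conv_iff[OF assms(1,4,5)])
qed

lemma conv_covers_pointwise:
  assumes "pointwise X" "U \<subseteq> pts X" "V \<subseteq> pts X"
    and "\<And>a b. a \<in> U \<Longrightarrow> b \<in> V \<Longrightarrow> {a} \<odot>\<^bsub>X\<^esub> {b} \<lhd>\<lhd>\<^bsub>Y\<^esub> W"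
  shows "U \<odot>\<^bsub>X\<^esub> V \<lhd>\<lhd>\<^bsub>Y\<^esub> W"
proof (rule coversI)
  fix x assume "x \<in> U \<odot>\<^bsub>X\<^esub> V"
  then have "\<exists>a\<in>U. \<exists>b\<in>V. x \<in> {a} \<odot>\<^bsub>X\<^esub> {b}"
    by (simp only: pointwise_conv_iff[OF assms(1-3)])
  then show "x \<lhd>\<^bsub>Y\<^esub> W" using coversD[OF assms(4)] by blast
qed

definition pointwise_convergent :: "'a conv_cover_str \<Rightarrow> bool" where
  "pointwise_convergent X \<longleftrightarrow> pointwise X \<and> convergent_cover X"

lemma pointwise_convergentD:
  assumes "pointwise_convergent X"
  shows "pointwise X" "convergent_cover X" "basic_cover X"
  using assms by (auto simp: pointwise_convergent_def convergent_cover_def)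

lemma conv_stable:
  assumes "convergent_cover X" "U \<lhd>\<lhd>\<^bsub>X\<^esub> U'" "V \<lhd>\<lhd>\<^bsub>X\<^esub> V'"
    "U \<subseteq> pts X" "V \<subseteq> pts X" "U' \<subseteq> pts X" "V' \<subseteq> pts X"
  shows "U \<odot>\<^bsub>X\<^esub> V \<lhd>\<lhd>\<^bsub>X\<^esub> U' \<odot>\<^bsub>X\<^esub> V'"
  using assms(1)[unfolded convergent_cover_def, THEN conjunct2, THEN conjunct2, THEN conjunct1]
    assms(2-) by simp

lemma conv_comm:
  assumes "convergent_cover X" "U \<subseteq> pts X" "V \<subseteq> pts X"
  shows "U \<odot>\<^bsub>X\<^esub> V \<lhd>\<lhd>\<^bsub>X\<^esub> V \<odot>\<^bsub>X\<^esub> U"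
  using assms(1)[unfolded convergent_cover_def, THEN conjunct2, THEN conjunct2, THEN conjunct2, THEN conjunct2, THEN conjunct1]
    assms(2-) by simp

lemma conv_assoc:
  assumes "convergent_cover X" "U \<subseteq> pts X" "V \<subseteq> pts X" "W \<subseteq> pts X"
  shows "(U \<odot>\<^bsub>X\<^esub> V) \<odot>\<^bsub>X\<^esub> W \<lhd>\<lhd>\<^bsub>X\<^esub> U \<odot>\<^bsub>X\<^esub> (V \<odot>\<^bsub>X\<^esub> W)"
  using assms(1)[unfolded convergent_cover_def, THEN conjunct2, THEN conjunct2, THEN conjunct2, THEN conjunct1]
    assms(2-) by simp

text \<open>One direction of associativity is an axiom; commutativity yields the other by rotating the factors.\<close>

lemma conv_assoc_rev:
  assumes X: "pointwise_convergent X" and UVW: "U \<subseteq> pts X" "V \<subseteq> pts X" "W \<subseteq> pts X"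
  shows "U \<odot>\<^bsub>X\<^esub> (V \<odot>\<^bsub>X\<^esub> W) \<lhd>\<lhd>\<^bsub>X\<^esub> (U \<odot>\<^bsub>X\<^esub> V) \<odot>\<^bsub>X\<^esub> W"
proof -
  note D = pointwise_convergentD[OF X] and S = pointwise_conv_subset[OF pointwise_convergentD(1)[OF X]]
    and T = covers_trans[OF pointwise_convergentD(3)[OF X]]
  have "U \<odot>\<^bsub>X\<^esub> (V \<odot>\<^bsub>X\<^esub> W) \<lhd>\<lhd>\<^bsub>X\<^esub> (V \<odot>\<^bsub>X\<^esub> W) \<odot>\<^bsub>X\<^esub> U"
    and "(V \<odot>\<^bsub>X\<^esub> W) \<odot>\<^bsub>X\<^esub> U \<lhd>\<lhd>\<^bsub>X\<^esub> V \<odot>\<^bsub>X\<^esub> (W \<odot>\<^bsub>X\<^esub> U)"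
    and "V \<odot>\<^bsub>X\<^esub> (W \<odot>\<^bsub>X\<^esub> U) \<lhd>\<lhd>\<^bsub>X\<^esub> (W \<odot>\<^bsub>X\<^esub> U) \<odot>\<^bsub>X\<^esub> V"
    and "(W \<odot>\<^bsub>X\<^esub> U) \<odot>\<^bsub>X\<^esub> V \<lhd>\<lhd>\<^bsub>X\<^esub> W \<odot>\<^bsub>X\<^esub> (U \<odot>\<^bsub>X\<^esub> V)"
    and "W \<odot>\<^bsub>X\<^esub> (U \<odot>\<^bsub>X\<^esub> V) \<lhd>\<lhd>\<^bsub>X\<^esub> (U \<odot>\<^bsub>X\<^esub> V) \<odot>\<^bsub>X\<^esub> W"
    by (intro conv_comm conv_assoc D(2) S UVW)+
  note steps = this
  show ?thesis
    by (rule T[OF _ steps(1) T[OF _ steps(2) T[OF _ steps(3) T[OF _ steps(4,5)]]]]; intro S UVW)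
qed

text \<open>
  For a pointwise operation, stability need only be checked for a single cover multiplied by a
  single point on the right: the union over the second argument gives stability in the first,
  and commutativity transfers this to the second. Distributivity over joins is then automatic,
  since a pointwise operation preserves unions in each argument on the nose.
\<close>

lemma pointwise_convergentI:
  assumes pw: "pointwise X" and bc: "basic_cover X"
    and loc: "\<And>a U c. a \<lhd>\<^bsub>X\<^esub> U \<Longrightarrow> c \<in> pts X \<Longrightarrow> {a} \<odot>\<^bsub>X\<^esub> {c} \<lhd>\<lhd>\<^bsub>X\<^esub> U \<odot>\<^bsub>X\<^esub> {c}"
    and comm: "\<And>U V. U \<subseteq> pts X \<Longrightarrow> V \<subseteq> pts X \<Longrightarrow> U \<odot>\<^bsub>X\<^esub> V \<lhd>\<lhd>\<^bsub>X\<^esub> V \<odot>\<^bsub>X\<^esub> U"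
    and assoc: "\<And>U V W. U \<subseteq> pts X \<Longrightarrow> V \<subseteq> pts X \<Longrightarrow> W \<subseteq> pts X \<Longrightarrow>
      (U \<odot>\<^bsub>X\<^esub> V) \<odot>\<^bsub>X\<^esub> W \<lhd>\<lhd>\<^bsub>X\<^esub> U \<odot>\<^bsub>X\<^esub> (V \<odot>\<^bsub>X\<^esub> W)"
  shows "pointwise_convergent X"
proof -
  note S = pointwise_conv_subset[OF pw] and I = pointwise_conv_iff[OF pw] and T = covers_trans[OF bc]
  have left: "U \<odot>\<^bsub>X\<^esub> V \<lhd>\<lhd>\<^bsub>X\<^esub> U' \<odot>\<^bsub>X\<^esub> V"
    if "U \<lhd>\<lhd>\<^bsub>X\<^esub> U'" "U \<subseteq> pts X" "U' \<subseteq> pts X" "V \<subseteq> pts X" for U U' V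
  proof (rule coversI)
    fix x assume "x \<in> U \<odot>\<^bsub>X\<^esub> V"
    then have "\<exists>a\<in>U. \<exists>b\<in>V. x \<in> {a} \<odot>\<^bsub>X\<^esub> {b}" using I[OF that(2,4)] by blast
    then obtain a b where ab: "a \<in> U" "b \<in> V" "x \<in> {a} \<odot>\<^bsub>X\<^esub> {b}" by blast
    then have "x \<lhd>\<^bsub>X\<^esub> U' \<odot>\<^bsub>X\<^esub> {b}" using loc[of a U' b] that by (auto simp: covers_def)
    moreover have "U' \<odot>\<^bsub>X\<^esub> {b} \<subseteq> U' \<odot>\<^bsub>X\<^esub> V"
      using pointwise_conv_mono[OF pw, of U' U' "{b}" V] that ab by auto
    ultimately show "x \<lhd>\<^bsub>X\<^esub> U' \<odot>\<^bsub>X\<^esub> V"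
      using cov_trans[OF bc S[OF that(3,4)]] covers_subset[OF bc S[OF that(3,4)]] by blast
  qed
  have stable: "U \<odot>\<^bsub>X\<^esub> V \<lhd>\<lhd>\<^bsub>X\<^esub> U' \<odot>\<^bsub>X\<^esub> V'"
    if "U \<lhd>\<lhd>\<^bsub>X\<^esub> U'" "V \<lhd>\<lhd>\<^bsub>X\<^esub> V'" "U \<subseteq> pts X" "U' \<subseteq> pts X" "V \<subseteq> pts X" "V' \<subseteq> pts X" for U U' V V'
  proof -
    have "U \<odot>\<^bsub>X\<^esub> V \<lhd>\<lhd>\<^bsub>X\<^esub> U' \<odot>\<^bsub>X\<^esub> V" "U' \<odot>\<^bsub>X\<^esub> V \<lhd>\<lhd>\<^bsub>X\<^esub> V \<odot>\<^bsub>X\<^esub> U'"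
      "V \<odot>\<^bsub>X\<^esub> U' \<lhd>\<lhd>\<^bsub>X\<^esub> V' \<odot>\<^bsub>X\<^esub> U'" "V' \<odot>\<^bsub>X\<^esub> U' \<lhd>\<lhd>\<^bsub>X\<^esub> U' \<odot>\<^bsub>X\<^esub> V'"
      by (intro left comm that)+
    note steps = this
    show ?thesis
      by (rule T[OF _ steps(1) T[OF _ steps(2) T[OF _ steps(3,4)]]]; intro S that)
  qed
  have clos: "U \<lhd>\<lhd>\<^bsub>X\<^esub> saturation X U" "saturation X U \<lhd>\<lhd>\<^bsub>X\<^esub> U" "saturation X U \<subseteq> pts X"
    if "U \<subseteq> pts X" for U
  proof -
    show "saturation X U \<lhd>\<lhd>\<^bsub>X\<^esub> U" "saturation X U \<subseteq> pts X" by (auto simp: saturation_def covers_def)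
    moreover have "U \<subseteq> saturation X U" using that bc by (auto simp: saturation_def intro: cov_refl)
    ultimately show "U \<lhd>\<lhd>\<^bsub>X\<^esub> saturation X U" by (intro covers_subset bc)
  qed
  \<comment> \<open>Saturating the members of a family first does not change the saturation of its union.\<close>
  have join: "Sat_join X (f ` \<Q>) = saturation X (\<Union>(g ` \<Q>))"
    if "\<And>Q. Q \<in> \<Q> \<Longrightarrow> g Q \<subseteq> pts X" "\<And>Q. Q \<in> \<Q> \<Longrightarrow> f Q = saturation X (g Q)" for f g \<Q>
  proof -
    have gs: "\<Union>(g ` \<Q>) \<subseteq> pts X" and fs: "\<Union>(f ` \<Q>) \<subseteq> pts X"
      using that by (auto simp: saturation_def)
    have "\<Union>(f ` \<Q>) \<lhd>\<lhd>\<^bsub>X\<^esub> \<Union>(g ` \<Q>)"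
    proof (rule coversI)
      fix a assume "a \<in> \<Union>(f ` \<Q>)"
      then have "\<exists>Q\<in>\<Q>. a \<lhd>\<^bsub>X\<^esub> g Q" using that(2) by (auto simp: saturation_def)
      then obtain Q where Q: "Q \<in> \<Q>" "a \<lhd>\<^bsub>X\<^esub> g Q" by blast
      then have "g Q \<lhd>\<lhd>\<^bsub>X\<^esub> \<Union>(g ` \<Q>)" by (intro covers_subset bc gs) auto
      then show "a \<lhd>\<^bsub>X\<^esub> \<Union>(g ` \<Q>)" using cov_trans[OF bc gs] Q by blast
    qed
    moreover have "\<Union>(g ` \<Q>) \<lhd>\<lhd>\<^bsub>X\<^esub> \<Union>(f ` \<Q>)"
    proof (rule covers_subset[OF bc fs])
      have "g Q \<subseteq> f Q" if "Q \<in> \<Q>" for Q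
        using that \<open>\<And>Q. Q \<in> \<Q> \<Longrightarrow> g Q \<subseteq> pts X\<close> \<open>\<And>Q. Q \<in> \<Q> \<Longrightarrow> f Q = saturation X (g Q)\<close>
          cov_refl[OF bc, of "g Q"] by (auto simp: saturation_def)
      then show "\<Union>(g ` \<Q>) \<subseteq> \<Union>(f ` \<Q>)" by blast
    qed
    ultimately show ?thesis
      unfolding Sat_join_def using saturation_eq_iff[OF bc fs gs] by blast
  qed
  have dist: "Sat_conv X P (Sat_join X \<Q>) = Sat_join X ((\<lambda>Q. Sat_conv X P Q) ` \<Q>) \<and>
      Sat_conv X (Sat_join X \<Q>) P = Sat_join X ((\<lambda>Q. Sat_conv X Q P) ` \<Q>)"
    if P: "P \<in> Sat X" and \<Q>: "\<Q> \<subseteq> Sat X" for P \<Q>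
  proof -
    have Ps: "P \<subseteq> pts X" and Qs: "\<And>Q. Q \<in> \<Q> \<Longrightarrow> Q \<subseteq> pts X" and UQ: "\<Union>\<Q> \<subseteq> pts X"
      using P \<Q> by (auto simp: Sat_def)
    note cl = clos[OF UQ]
    have refl: "P \<lhd>\<lhd>\<^bsub>X\<^esub> P" by (intro covers_subset bc Ps order_refl)
    have "P \<odot>\<^bsub>X\<^esub> saturation X (\<Union>\<Q>) \<lhd>\<lhd>\<^bsub>X\<^esub> P \<odot>\<^bsub>X\<^esub> \<Union>\<Q>"
      "P \<odot>\<^bsub>X\<^esub> \<Union>\<Q> \<lhd>\<lhd>\<^bsub>X\<^esub> P \<odot>\<^bsub>X\<^esub> saturation X (\<Union>\<Q>)"
      "saturation X (\<Union>\<Q>) \<odot>\<^bsub>X\<^esub> P \<lhd>\<lhd>\<^bsub>X\<^esub> \<Union>\<Q> \<odot>\<^bsub>X\<^esub> P"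
      "\<Union>\<Q> \<odot>\<^bsub>X\<^esub> P \<lhd>\<lhd>\<^bsub>X\<^esub> saturation X (\<Union>\<Q>) \<odot>\<^bsub>X\<^esub> P"
      by (intro stable refl cl Ps UQ)+
    then have "Sat_conv X P (Sat_join X \<Q>) = saturation X (P \<odot>\<^bsub>X\<^esub> \<Union>\<Q>)"
      and "Sat_conv X (Sat_join X \<Q>) P = saturation X (\<Union>\<Q> \<odot>\<^bsub>X\<^esub> P)"
      unfolding Sat_conv_def Sat_join_def by (subst saturation_eq_iff[OF bc]; (intro S Ps UQ cl | simp))+
    moreover have "P \<odot>\<^bsub>X\<^esub> \<Union>\<Q> = (\<Union>Q\<in>\<Q>. P \<odot>\<^bsub>X\<^esub> Q)"
      by (simp add: set_eq_iff I[OF Ps UQ] I[OF Ps Qs]; blast)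
    moreover have "\<Union>\<Q> \<odot>\<^bsub>X\<^esub> P = (\<Union>Q\<in>\<Q>. Q \<odot>\<^bsub>X\<^esub> P)"
      by (simp add: set_eq_iff I[OF UQ Ps] I[OF Qs Ps]; blast)
    moreover have "Sat_join X ((\<lambda>Q. Sat_conv X P Q) ` \<Q>) = saturation X (\<Union>Q\<in>\<Q>. P \<odot>\<^bsub>X\<^esub> Q)"
      "Sat_join X ((\<lambda>Q. Sat_conv X Q P) ` \<Q>) = saturation X (\<Union>Q\<in>\<Q>. Q \<odot>\<^bsub>X\<^esub> P)"
      by (intro join S Ps Qs; simp add: Sat_conv_def)+
    ultimately show ?thesis by simp
  qed
  have "case_prod (conv X) \<in> Pow (pts X) \<times> Pow (pts X) \<rightarrow>\<^sub>E Pow (pts X)"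
  proof (rule PiE_I)
    fix p assume "p \<in> Pow (pts X) \<times> Pow (pts X)"
    then show "case_prod (conv X) p \<in> Pow (pts X)" using S by auto
  next
    fix p assume "p \<notin> Pow (pts X) \<times> Pow (pts X)"
    moreover obtain \<delta> where "conv X = conv_of (pts X) \<delta>"
      using pw by (auto simp: pointwise_def)
    ultimately show "case_prod (conv X) p = undefined"
      by (cases p) (simp add: conv_of_def, blast)
  qed
  note undefined_outside = this
  show ?thesis
    unfolding pointwise_convergent_def convergent_cover_def
    by (intro conjI ballI allI impI pw bc undefined_outside;
        (rule stable comm assoc dist[THEN conjunct1] dist[THEN conjunct2]; simp))
qed

section \<open>Every pointwise cover is inductively generated\<close>

text \<open>
  The largest axiom-set that a cover validates. Each covering set serves as its own index, which
  is why indices of type \<open>'a set\<close> are enough.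
\<close>

definition all_covers :: "'a conv_cover_str \<Rightarrow> ('a, 'a set) axiom_set" where
  "all_covers X = \<lparr>ax_index = (\<lambda>a. {U. a \<lhd>\<^bsub>X\<^esub> U}), ax_set = (\<lambda>a U. U)\<rparr>"

lemma cov_eq_generated:
  assumes bc: "basic_cover X"
    and sound: "\<And>a i. a \<in> pts X \<Longrightarrow> i \<in> ax_index A a \<Longrightarrow> a \<lhd>\<^bsub>X\<^esub> ax_set A a i"
    and complete: "\<And>a U. a \<lhd>\<^bsub>X\<^esub> U \<Longrightarrow> \<exists>i\<in>ax_index A a. ax_set A a i = U"
  shows "cov X = generated (pts X) A"
proof (intro ext iffI)
  fix a U assume "a \<lhd>\<^bsub>X\<^esub> U"
  then show "generated (pts X) A a U"
    using complete[of a U] cov_pts[OF bc] by (metis generated.intros)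
next
  fix a U assume "generated (pts X) A a U"
  then show "a \<lhd>\<^bsub>X\<^esub> U"
  proof induction
    case (refl a U)
    then show ?case using cov_refl[OF bc] by blast
  next
    case (infinity a U i)
    then show ?case using cov_trans[OF bc infinity(2) sound[OF infinity(1,3)]] by (simp add: covers_def)
  qed
qed

text \<open>
  With all valid covers as the given axioms, each further stage adds only axioms that the cover
  already validates: commutativity and associativity at the first stage, their localisations,
  which are instances of stability, at the second.
\<close>

lemma J_axioms_sound:
  assumes X: "pointwise_convergent X" and conv: "conv X = conv_of (pts X) \<delta>"
    and i: "i \<in> ax_index (J_axioms (pts X) \<delta> (all_covers X)) a"
  shows "a \<lhd>\<^bsub>X\<^esub> ax_set (J_axioms (pts X) \<delta> (all_covers X)) a i"
proof (cases i)
  case (Given U)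
  then show ?thesis using i by (auto simp: J_axioms_def all_covers_def Let_def)
next
  case (Comm b c)
  then show ?thesis using i conv_comm[OF pointwise_convergentD(2)[OF X], of "{b}" "{c}"]
    by (auto simp: J_axioms_def Let_def covers_def simp flip: conv)
next
  case (Assoc b c d)
  then show ?thesis using i conv_assoc[OF pointwise_convergentD(2)[OF X], of "{b}" "{c}" "{d}"]
    by (auto simp: J_axioms_def Let_def covers_def simp flip: conv)
qed

lemma J'_axioms_sound:
  assumes X: "pointwise_convergent X" and conv: "conv X = conv_of (pts X) \<delta>"
    and i: "i \<in> ax_index (J'_axioms (pts X) \<delta> (all_covers X)) a"
  shows "a \<lhd>\<^bsub>X\<^esub> ax_set (J'_axioms (pts X) \<delta> (all_covers X)) a i"
proof (cases i)
  case (Unlocalized j)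
  then show ?thesis using i J_axioms_sound[OF X conv] by (auto simp: J'_axioms_def Let_def)
next
  case (Localized b j c)
  note D = pointwise_convergentD[OF X]
  define U where "U = ax_set (J_axioms (pts X) \<delta> (all_covers X)) b j"
  have *: "b \<in> pts X" "c \<in> pts X" "a \<in> {b} \<odot>\<^bsub>X\<^esub> {c}" "b \<lhd>\<^bsub>X\<^esub> U"
    using i Localized J_axioms_sound[OF X conv, of j b] by (auto simp: J'_axioms_def Let_def U_def simp flip: conv)
  then have "{b} \<odot>\<^bsub>X\<^esub> {c} \<lhd>\<lhd>\<^bsub>X\<^esub> U \<odot>\<^bsub>X\<^esub> {c}"
    using cov_pts[OF D(3)] by (intro conv_stable D(2)) (auto simp: covers_def intro: cov_refl[OF D(3)])
  then have "a \<lhd>\<^bsub>X\<^esub> U \<odot>\<^bsub>X\<^esub> {c}" using * by (simp add: covers_def)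
  then show ?thesis using Localized by (simp add: J'_axioms_def Let_def U_def flip: conv)
qed

lemma ind_gen_convergent_iff: "ind_gen_convergent X \<longleftrightarrow> pointwise_convergent X"
proof
  assume "ind_gen_convergent X"
  then show "pointwise_convergent X"
    by (auto simp: ind_gen_convergent_def pointwise_convergent_def pointwise_def)
next
  assume X: "pointwise_convergent X"
  note D = pointwise_convergentD[OF X]
  obtain \<delta> where \<delta>: "\<delta> \<in> pts X \<times> pts X \<rightarrow> Pow (pts X)" and conv: "conv X = conv_of (pts X) \<delta>"
    using D(1) by (auto simp: pointwise_def)
  have "cov X = generated (pts X) (J'_axioms (pts X) \<delta> (all_covers X))"
  proof (rule cov_eq_generated[OF D(3)])
    fix a U assume "a \<lhd>\<^bsub>X\<^esub> U"
    then show "\<exists>i\<in>ax_index (J'_axioms (pts X) \<delta> (all_covers X)) a.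
        ax_set (J'_axioms (pts X) \<delta> (all_covers X)) a i = U"
      by (intro bexI[of _ "Unlocalized (Given U)"]) (auto simp: J'_axioms_def J_axioms_def all_covers_def Let_def)
  qed (rule J'_axioms_sound[OF X conv])
  moreover have "axiom_set_on (pts X) (all_covers X)"
    using cov_pts[OF D(3)] by (auto simp: axiom_set_on_def all_covers_def)
  ultimately show "ind_gen_convergent X"
    unfolding ind_gen_convergent_def using D(2) \<delta> conv by (intro conjI exI)
qed

lemma formal_weakening:
  assumes "formal_cover X" "U \<subseteq> pts X" "V \<subseteq> pts X"
  shows "U \<odot>\<^bsub>X\<^esub> V \<lhd>\<lhd>\<^bsub>X\<^esub> V"
proof -
  have "convergent_cover X" and m: "saturation X (U \<odot>\<^bsub>X\<^esub> V) = saturation X U \<inter> saturation X V"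
    using assms by (auto simp: formal_cover_def)
  then have bc: "basic_cover X"
    and "case_prod (conv X) \<in> Pow (pts X) \<times> Pow (pts X) \<rightarrow>\<^sub>E Pow (pts X)"
    unfolding convergent_cover_def by - (elim conjE, assumption)+
  then have sub: "U \<odot>\<^bsub>X\<^esub> V \<subseteq> pts X"
    using assms(2,3) by (auto dest!: PiE_mem[where x = "(U, V)"])
  have "U \<odot>\<^bsub>X\<^esub> V \<subseteq> saturation X (U \<odot>\<^bsub>X\<^esub> V)" using sub cov_refl[OF bc sub] by (auto simp: saturation_def)
  then show ?thesis unfolding m unfolding saturation_def covers_def by blast
qed

lemma formal_contraction:
  assumes "formal_cover X" "U \<subseteq> pts X"
  shows "U \<lhd>\<lhd>\<^bsub>X\<^esub> U \<odot>\<^bsub>X\<^esub> U"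
proof -
  have bc: "basic_cover X" and m: "saturation X (U \<odot>\<^bsub>X\<^esub> U) = saturation X U"
    using assms by (auto simp: formal_cover_def convergent_cover_def)
  have "U \<subseteq> saturation X U" using assms(2) cov_refl[OF bc] by (auto simp: saturation_def)
  then show ?thesis unfolding m[symmetric] unfolding saturation_def covers_def by blast
qed

lemma ind_gen_formal_iff: "ind_gen_formal X \<longleftrightarrow> pointwise X \<and> formal_cover X"
proof
  assume "ind_gen_formal X"
  then show "pointwise X \<and> formal_cover X"
    by (auto simp: ind_gen_formal_def pointwise_def)
next
  assume X: "pointwise X \<and> formal_cover X"
  then have pc: "pointwise_convergent X" by (simp add: pointwise_convergent_def formal_cover_def)
  note D = pointwise_convergentD[OF pc]
  obtain \<delta> where \<delta>: "\<delta> \<in> pts X \<times> pts X \<rightarrow> Pow (pts X)" and conv: "conv X = conv_of (pts X) \<delta>"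
    using D(1) by (auto simp: pointwise_def)
  let ?A = "J''_axioms (pts X) \<delta> (all_covers X)"
  have "cov X = generated (pts X) ?A"
  proof (rule cov_eq_generated[OF D(3)])
    fix a U assume "a \<lhd>\<^bsub>X\<^esub> U"
    then show "\<exists>i\<in>ax_index ?A a. ax_set ?A a i = U"
      by (intro bexI[of _ "Convergent (Unlocalized (Given U))"])
        (auto simp: J''_axioms_def J'_axioms_def J_axioms_def all_covers_def Let_def)
  next
    fix a i assume a: "a \<in> pts X" and i: "i \<in> ax_index ?A a"
    show "a \<lhd>\<^bsub>X\<^esub> ax_set ?A a i"
    proof (cases i)
      case (Convergent k)
      then show ?thesis using i J'_axioms_sound[OF pc conv] by (auto simp: J''_axioms_def Let_def)
    next
      case (Weakening b c)
      then show ?thesis using i X formal_weakening[of X "{b}" "{c}"]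
        by (auto simp: J''_axioms_def Let_def covers_def simp flip: conv)
    next
      case Contraction
      then show ?thesis using a X formal_contraction[of X "{a}"]
        by (auto simp: J''_axioms_def Let_def covers_def simp flip: conv)
    qed
  qed
  moreover have "axiom_set_on (pts X) (all_covers X)"
    using cov_pts[OF D(3)] by (auto simp: axiom_set_on_def all_covers_def)
  ultimately show "ind_gen_formal X"
    unfolding ind_gen_formal_def using conjunct2[OF X] \<delta> conv by (intro conjI exI)
qed

section \<open>The formal cover of a convergent cover\<close>

text \<open>
  The rules \<open>weakening\<close> and \<open>contraction\<close> are the two axioms that turn a convergent cover into a
  formal one, each composed with transitivity. Rule \<open>cov\<close> treats all covers of \<open>X\<close> as axioms, so the relation
  depends only on \<open>X\<close> and not on a choice of axioms generating it.
\<close>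

inductive formal_cov :: "'a conv_cover_str \<Rightarrow> 'a \<Rightarrow> 'a set \<Rightarrow> bool" for X where
  refl: "a \<in> U \<Longrightarrow> U \<subseteq> pts X \<Longrightarrow> formal_cov X a U"
| cov: "a \<lhd>\<^bsub>X\<^esub> V \<Longrightarrow> U \<subseteq> pts X \<Longrightarrow> (\<And>b. b \<in> V \<Longrightarrow> formal_cov X b U) \<Longrightarrow> formal_cov X a U"
| weakening: "b \<in> pts X \<Longrightarrow> c \<in> pts X \<Longrightarrow> a \<in> {b} \<odot>\<^bsub>X\<^esub> {c} \<Longrightarrow> formal_cov X c U \<Longrightarrow> formal_cov X a U"
| contraction: "a \<in> pts X \<Longrightarrow> U \<subseteq> pts X \<Longrightarrow> (\<And>b. b \<in> {a} \<odot>\<^bsub>X\<^esub> {a} \<Longrightarrow> formal_cov X b U) \<Longrightarrow>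
    formal_cov X a U"

definition formalize :: "'a conv_cover_str \<Rightarrow> 'a conv_cover_str" where
  "formalize X = X\<lparr>cov := formal_cov X\<rparr>"

lemma formalize_simps [simp]:
  "pts (formalize X) = pts X" "conv (formalize X) = conv X" "cov (formalize X) = formal_cov X"
  by (simp_all add: formalize_def)

lemma pointwise_formalize [simp]: "pointwise (formalize X) \<longleftrightarrow> pointwise X"
  by (simp add: pointwise_def)

lemma formal_cov_pts:
  assumes "pointwise_convergent X" "formal_cov X a U"
  shows "a \<in> pts X \<and> U \<subseteq> pts X"
  using assms(2)
proof induction
  case (cov a V U)
  then show ?case using cov_pts[OF pointwise_convergentD(3)[OF assms(1)]] by blast
next
  case (weakening b c a U)
  then show ?case using pointwise_conv_subset[OF pointwise_convergentD(1)[OF assms(1)], of "{b}" "{c}"] by auto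
qed auto

lemma formal_cov_trans:
  assumes "formal_cov X a U" "\<And>b. b \<in> U \<Longrightarrow> formal_cov X b V" "V \<subseteq> pts X"
  shows "formal_cov X a V"
  using assms
proof induction
  case (cov a W U)
  then show ?case by (intro formal_cov.cov[OF cov(1)]) auto
next
  case (weakening b c a U)
  then show ?case by (intro formal_cov.weakening[OF weakening(1-3)]) auto
next
  case (contraction a U)
  then show ?case by (intro formal_cov.contraction[OF contraction(1)]) auto
qed

lemma basic_cover_formalize:
  assumes "pointwise_convergent X"
  shows "basic_cover (formalize X)"
  unfolding basic_cover_def covers_def formalize_simps
proof (intro conjI allI impI)
  fix a U V
  { assume "formal_cov X a U"
    then show "a \<in> pts X" "U \<subseteq> pts X" using formal_cov_pts[OF assms] by auto }
  { assume "U \<subseteq> pts X" "a \<in> U"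
    then show "formal_cov X a U" by (rule formal_cov.refl[rotated]) }
  { assume "V \<subseteq> pts X" "formal_cov X a U" "\<forall>b\<in>U. formal_cov X b V"
    then show "formal_cov X a V" by (intro formal_cov_trans[of X a U V]) auto }
qed

lemma covers_formalize:
  assumes "U \<lhd>\<lhd>\<^bsub>X\<^esub> V" "V \<subseteq> pts X"
  shows "U \<lhd>\<lhd>\<^bsub>formalize X\<^esub> V"
proof (rule coversI, unfold formalize_simps)
  fix a assume "a \<in> U"
  with assms show "formal_cov X a V"
    by (intro formal_cov.cov[of X a V V]) (auto dest: coversD intro: formal_cov.refl)
qed

lemma formalize_weakening:
  assumes "pointwise_convergent X" "U \<subseteq> pts X" "V \<subseteq> pts X"
  shows "U \<odot>\<^bsub>X\<^esub> V \<lhd>\<lhd>\<^bsub>formalize X\<^esub> V"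
proof (rule coversI)
  fix a assume "a \<in> U \<odot>\<^bsub>X\<^esub> V"
  then have "\<exists>b\<in>U. \<exists>c\<in>V. a \<in> {b} \<odot>\<^bsub>X\<^esub> {c}"
    by (simp only: pointwise_conv_iff[OF pointwise_convergentD(1)[OF assms(1)] assms(2,3)])
  then obtain b c where "b \<in> U" "c \<in> V" "a \<in> {b} \<odot>\<^bsub>X\<^esub> {c}" by blast
  then show "a \<lhd>\<^bsub>formalize X\<^esub> V"
    unfolding formalize_simps using assms
    by (intro formal_cov.weakening[of b X c a V] formal_cov.refl) auto
qed

text \<open>
  Stability of the enlarged relation, by induction on its derivation. No localised form of
  weakening or contraction was put into the definition, so both have to be recovered from the
  convergent structure of \<open>X\<close>. For weakening, \<open>(b \<odot> d) \<odot> c\<close> is rebracketed to \<open>b \<odot> (d \<odot> c)\<close>, to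
  which weakening applies. For contraction, a point of \<open>a \<odot> c\<close> is itself contracted, and the
  square \<open>(a \<odot> c) \<odot> (a \<odot> c)\<close> is rearranged to \<open>c \<odot> ((a \<odot> a) \<odot> c)\<close>; weakening removes the superfluous
  factor \<open>c\<close>.
\<close>

lemma formalize_local:
  assumes X: "pointwise_convergent X" and "formal_cov X a U" and c: "c \<in> pts X"
  shows "{a} \<odot>\<^bsub>X\<^esub> {c} \<lhd>\<lhd>\<^bsub>formalize X\<^esub> U \<odot>\<^bsub>X\<^esub> {c}"
  using assms(2)
proof induction
  case (refl a U)
  note pw = pointwise_convergentD(1)[OF X]
  have "U \<odot>\<^bsub>X\<^esub> {c} \<subseteq> pts (formalize X)"
    using pointwise_conv_subset[OF pw] refl c by simp
  moreover have "{a} \<odot>\<^bsub>X\<^esub> {c} \<subseteq> U \<odot>\<^bsub>X\<^esub> {c}"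
    using refl c by (intro pointwise_conv_mono pw) auto
  ultimately show ?case by (intro covers_subset basic_cover_formalize X)
next
  case (cov a V U)
  note D = pointwise_convergentD[OF X]
  have V: "a \<in> pts X" "V \<subseteq> pts X" using cov_pts[OF D(3) cov(1)] by auto
  have "{a} \<odot>\<^bsub>X\<^esub> {c} \<lhd>\<lhd>\<^bsub>X\<^esub> V \<odot>\<^bsub>X\<^esub> {c}"
    using cov(1) V c by (intro conv_stable D(2)) (auto simp: covers_def intro: cov_refl[OF D(3)])
  then have 1: "{a} \<odot>\<^bsub>X\<^esub> {c} \<lhd>\<lhd>\<^bsub>formalize X\<^esub> V \<odot>\<^bsub>X\<^esub> {c}"
    using V c by (intro covers_formalize pointwise_conv_subset D(1)) auto
  have 2: "V \<odot>\<^bsub>X\<^esub> {c} \<lhd>\<lhd>\<^bsub>formalize X\<^esub> U \<odot>\<^bsub>X\<^esub> {c}"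
    by (rule conv_covers_pointwise[OF D(1)]) (use V c cov(4) in auto)
  show ?case
    by (rule covers_trans[OF basic_cover_formalize[OF X] _ 1 2])
      (use cov(2) c in \<open>simp add: pointwise_conv_subset[OF D(1)]\<close>)
next
  case (weakening b d a U)
  note D = pointwise_convergentD[OF X]
  note S = pointwise_conv_subset[OF D(1)]
  have U: "U \<subseteq> pts X" using formal_cov_pts[OF X weakening(4)] by simp
  have bdc: "{b} \<subseteq> pts X" "{d} \<subseteq> pts X" "{c} \<subseteq> pts X" using weakening c by auto
  note T = covers_trans[OF basic_cover_formalize[OF X], unfolded formalize_simps]
  have "{a} \<odot>\<^bsub>X\<^esub> {c} \<subseteq> ({b} \<odot>\<^bsub>X\<^esub> {d}) \<odot>\<^bsub>X\<^esub> {c}"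
    using weakening by (intro pointwise_conv_mono D(1) S bdc) auto
  then have 1: "{a} \<odot>\<^bsub>X\<^esub> {c} \<lhd>\<lhd>\<^bsub>X\<^esub> ({b} \<odot>\<^bsub>X\<^esub> {d}) \<odot>\<^bsub>X\<^esub> {c}"
    by (intro covers_subset D(3) S bdc)
  have 2: "({b} \<odot>\<^bsub>X\<^esub> {d}) \<odot>\<^bsub>X\<^esub> {c} \<lhd>\<lhd>\<^bsub>X\<^esub> {b} \<odot>\<^bsub>X\<^esub> ({d} \<odot>\<^bsub>X\<^esub> {c})"
    by (intro conv_assoc D(2) bdc)
  have 3: "{a} \<odot>\<^bsub>X\<^esub> {c} \<lhd>\<lhd>\<^bsub>formalize X\<^esub> {b} \<odot>\<^bsub>X\<^esub> ({d} \<odot>\<^bsub>X\<^esub> {c})"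
    by (rule covers_formalize[OF covers_trans[OF D(3) _ 1 2]]) (intro S bdc)+
  have 4: "{b} \<odot>\<^bsub>X\<^esub> ({d} \<odot>\<^bsub>X\<^esub> {c}) \<lhd>\<lhd>\<^bsub>formalize X\<^esub> {d} \<odot>\<^bsub>X\<^esub> {c}"
    by (intro formalize_weakening X S bdc)
  show ?case
    by (rule T[OF _ T[OF _ 3 4] weakening(5)]) (intro S U bdc)+
next
  case (contraction a U)
  note D = pointwise_convergentD[OF X]
  note S = pointwise_conv_subset[OF D(1)]
  note T = covers_trans[OF basic_cover_formalize[OF X], unfolded formalize_simps]
  let ?A = "{a}" and ?C = "{c}"
  have ac: "?A \<subseteq> pts X" "?C \<subseteq> pts X" using contraction(1) c by auto
  have 1: "(?A \<odot>\<^bsub>X\<^esub> ?C) \<odot>\<^bsub>X\<^esub> (?A \<odot>\<^bsub>X\<^esub> ?C) \<lhd>\<lhd>\<^bsub>X\<^esub> (?C \<odot>\<^bsub>X\<^esub> ?A) \<odot>\<^bsub>X\<^esub> (?A \<odot>\<^bsub>X\<^esub> ?C)"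
    by (rule conv_stable[OF D(2) conv_comm[OF D(2)] covers_subset[OF D(3) _ order_refl]]; intro S ac)
  have 2: "(?C \<odot>\<^bsub>X\<^esub> ?A) \<odot>\<^bsub>X\<^esub> (?A \<odot>\<^bsub>X\<^esub> ?C) \<lhd>\<lhd>\<^bsub>X\<^esub> ?C \<odot>\<^bsub>X\<^esub> (?A \<odot>\<^bsub>X\<^esub> (?A \<odot>\<^bsub>X\<^esub> ?C))"
    by (rule conv_assoc[OF D(2)]; intro S ac)
  have 3: "?C \<odot>\<^bsub>X\<^esub> (?A \<odot>\<^bsub>X\<^esub> (?A \<odot>\<^bsub>X\<^esub> ?C)) \<lhd>\<lhd>\<^bsub>X\<^esub> ?C \<odot>\<^bsub>X\<^esub> ((?A \<odot>\<^bsub>X\<^esub> ?A) \<odot>\<^bsub>X\<^esub> ?C)"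
    by (rule conv_stable[OF D(2) covers_subset[OF D(3) _ order_refl] conv_assoc_rev[OF X]]; intro S ac)
  have rearrange:
    "(?A \<odot>\<^bsub>X\<^esub> ?C) \<odot>\<^bsub>X\<^esub> (?A \<odot>\<^bsub>X\<^esub> ?C) \<lhd>\<lhd>\<^bsub>X\<^esub> ?C \<odot>\<^bsub>X\<^esub> ((?A \<odot>\<^bsub>X\<^esub> ?A) \<odot>\<^bsub>X\<^esub> ?C)"
    by (rule covers_trans[OF D(3) _ 1 covers_trans[OF D(3) _ 2 3]]; intro S ac)
  have drop: "?C \<odot>\<^bsub>X\<^esub> ((?A \<odot>\<^bsub>X\<^esub> ?A) \<odot>\<^bsub>X\<^esub> ?C) \<lhd>\<lhd>\<^bsub>formalize X\<^esub> (?A \<odot>\<^bsub>X\<^esub> ?A) \<odot>\<^bsub>X\<^esub> ?C"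
    by (intro formalize_weakening X S ac)
  have IH: "(?A \<odot>\<^bsub>X\<^esub> ?A) \<odot>\<^bsub>X\<^esub> ?C \<lhd>\<lhd>\<^bsub>formalize X\<^esub> U \<odot>\<^bsub>X\<^esub> ?C"
    by (rule conv_covers_pointwise[OF D(1)]; (intro S ac)?) (use contraction(4) in auto)
  have U: "U \<odot>\<^bsub>X\<^esub> ?C \<subseteq> pts X" by (intro S contraction(2) ac)
  have square: "(?A \<odot>\<^bsub>X\<^esub> ?C) \<odot>\<^bsub>X\<^esub> (?A \<odot>\<^bsub>X\<^esub> ?C) \<lhd>\<lhd>\<^bsub>formalize X\<^esub> U \<odot>\<^bsub>X\<^esub> ?C"
    by (rule T[OF U covers_formalize[OF rearrange] T[OF U drop IH]]; intro S ac)
  show ?case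
  proof (rule coversI, unfold formalize_simps, rule formal_cov.contraction)
    fix x assume x: "x \<in> ?A \<odot>\<^bsub>X\<^esub> ?C"
    then show "x \<in> pts X" using S[OF ac] by blast
    fix y assume "y \<in> {x} \<odot>\<^bsub>X\<^esub> {x}"
    moreover have "{x} \<odot>\<^bsub>X\<^esub> {x} \<subseteq> (?A \<odot>\<^bsub>X\<^esub> ?C) \<odot>\<^bsub>X\<^esub> (?A \<odot>\<^bsub>X\<^esub> ?C)"
      using x by (intro pointwise_conv_mono D(1) S ac) auto
    ultimately have "y \<in> (?A \<odot>\<^bsub>X\<^esub> ?C) \<odot>\<^bsub>X\<^esub> (?A \<odot>\<^bsub>X\<^esub> ?C)" by blast
    then show "formal_cov X y (U \<odot>\<^bsub>X\<^esub> ?C)" using coversD[OF square] by simp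
  qed (rule U)
qed

text \<open>
  Weakening, on either side by commutativity, bounds \<open>U \<odot> V\<close> by the meet. Conversely, if \<open>a\<close> is
  covered by both \<open>U\<close> and \<open>V\<close>, then \<open>{a} \<odot> {a}\<close> is covered by \<open>U \<odot> V\<close> by stability, and
  contraction applies.
\<close>

lemma formal_cover_formalize:
  assumes X: "pointwise_convergent X"
  shows "formal_cover (formalize X)"
proof -
  note D = pointwise_convergentD[OF X]
  note S = pointwise_conv_subset[OF D(1)]
  have pc: "pointwise_convergent (formalize X)"
    by (rule pointwise_convergentI)
      (simp_all add: D(1) basic_cover_formalize[OF X] formalize_local[OF X]
        covers_formalize conv_comm[OF D(2)] conv_assoc[OF D(2)] S)
  note D' = pointwise_convergentD[OF pc]
  have "saturation (formalize X) (U \<odot>\<^bsub>X\<^esub> V) = saturation (formalize X) U \<inter> saturation (formalize X) V"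
    if UV: "U \<subseteq> pts X" "V \<subseteq> pts X" for U V
  proof (intro equalityI Int_greatest)
    have "U \<odot>\<^bsub>X\<^esub> V \<lhd>\<lhd>\<^bsub>formalize X\<^esub> V \<odot>\<^bsub>X\<^esub> U"
      using UV by (intro covers_formalize conv_comm D(2) S)
    from covers_trans[OF D'(3) _ this formalize_weakening[OF X UV(2,1)]]
    have "U \<odot>\<^bsub>X\<^esub> V \<lhd>\<lhd>\<^bsub>formalize X\<^esub> U" using UV by simp
    from cov_trans[OF D'(3) _ _ this]
    show "saturation (formalize X) (U \<odot>\<^bsub>X\<^esub> V) \<subseteq> saturation (formalize X) U"
      using UV by (auto simp: saturation_def)
    from cov_trans[OF D'(3) _ _ formalize_weakening[OF X UV]]
    show "saturation (formalize X) (U \<odot>\<^bsub>X\<^esub> V) \<subseteq> saturation (formalize X) V"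
      using UV by (auto simp: saturation_def)
    show "saturation (formalize X) U \<inter> saturation (formalize X) V \<subseteq> saturation (formalize X) (U \<odot>\<^bsub>X\<^esub> V)"
    proof
      fix a assume "a \<in> saturation (formalize X) U \<inter> saturation (formalize X) V"
      then have a: "a \<in> pts X" "formal_cov X a U" "formal_cov X a V" by (auto simp: saturation_def)
      then have "{a} \<odot>\<^bsub>X\<^esub> {a} \<lhd>\<lhd>\<^bsub>formalize X\<^esub> U \<odot>\<^bsub>X\<^esub> V"
        using conv_stable[OF D'(2), of "{a}" U "{a}" V] UV by (simp add: covers_def)
      then have "formal_cov X a (U \<odot>\<^bsub>X\<^esub> V)"
        using a(1) S[OF UV] by - (rule formal_cov.contraction, auto simp: covers_def)
      then show "a \<in> saturation (formalize X) (U \<odot>\<^bsub>X\<^esub> V)" using a by (simp add: saturation_def)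
    qed
  qed
  then show ?thesis using D' by (simp add: formal_cover_def)
qed

lemma formalize_formal:
  assumes "pointwise X" "formal_cover X"
  shows "formalize X = X"
proof -
  have X: "pointwise_convergent X" using assms by (simp add: pointwise_convergent_def formal_cover_def)
  note bc = pointwise_convergentD(3)[OF X]
  have "a \<lhd>\<^bsub>X\<^esub> U" if "formal_cov X a U" for a U
    using that
  proof induction
    case (refl a U)
    then show ?case by (intro cov_refl[OF bc])
  next
    case (cov a V U)
    then show ?case by (intro cov_trans[OF bc cov(2,1)] coversI)
  next
    case (weakening b c a U)
    have "{b} \<odot>\<^bsub>X\<^esub> {c} \<lhd>\<lhd>\<^bsub>X\<^esub> {c}"
      using weakening by (intro formal_weakening assms(2)) auto
    then have "a \<lhd>\<^bsub>X\<^esub> {c}" using weakening(3) by (rule coversD)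
    moreover have "{c} \<lhd>\<lhd>\<^bsub>X\<^esub> U" using weakening(5) by (simp add: covers_def)
    ultimately show ?case by (rule cov_trans[OF bc cov_pts(2)[OF bc weakening(5)]])
  next
    case (contraction a U)
    have "{a} \<lhd>\<lhd>\<^bsub>X\<^esub> {a} \<odot>\<^bsub>X\<^esub> {a}"
      using contraction by (intro formal_contraction assms(2)) auto
    then have "a \<lhd>\<^bsub>X\<^esub> {a} \<odot>\<^bsub>X\<^esub> {a}" by (rule coversD) simp
    moreover have "{a} \<odot>\<^bsub>X\<^esub> {a} \<lhd>\<lhd>\<^bsub>X\<^esub> U" using contraction(4) by (rule coversI)
    ultimately show ?case by (rule cov_trans[OF bc contraction(2)])
  qed
  moreover have "formal_cov X a U" if "a \<lhd>\<^bsub>X\<^esub> U" for a U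
    using cov_pts(2)[OF bc that] by (intro formal_cov.cov[OF that]) (auto intro: formal_cov.refl)
  ultimately have "formal_cov X = cov X" by (intro ext iffI)
  then show ?thesis by (simp add: formalize_def)
qed

section \<open>Units and maps\<close>

lemma unit_covers_conv:
  assumes X: "pointwise_convergent X" and E: "is_unit X E" and U: "U \<subseteq> pts X"
  shows "U \<lhd>\<lhd>\<^bsub>X\<^esub> U \<odot>\<^bsub>X\<^esub> E" "E \<odot>\<^bsub>X\<^esub> U \<lhd>\<lhd>\<^bsub>X\<^esub> U"
proof -
  note D = pointwise_convergentD[OF X] and S = pointwise_conv_subset[OF pointwise_convergentD(1)[OF X]]
  have Es: "E \<subseteq> pts X" using E by (simp add: is_unit_def)
  have unit: "{a} \<lhd>\<lhd>\<^bsub>X\<^esub> {a} \<odot>\<^bsub>X\<^esub> E" "E \<odot>\<^bsub>X\<^esub> {a} \<lhd>\<lhd>\<^bsub>X\<^esub> {a}" if "a \<in> U" for a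
  proof -
    have a: "a \<in> pts X" "{a} \<subseteq> pts X" using that U by auto
    have "saturation X ({a} \<odot>\<^bsub>X\<^esub> E) = saturation X {a}" "saturation X (E \<odot>\<^bsub>X\<^esub> {a}) = saturation X {a}"
      using E a(1) by (auto simp: is_unit_def)
    then show "{a} \<lhd>\<lhd>\<^bsub>X\<^esub> {a} \<odot>\<^bsub>X\<^esub> E" "E \<odot>\<^bsub>X\<^esub> {a} \<lhd>\<lhd>\<^bsub>X\<^esub> {a}"
      using saturation_eq_iff[OF D(3) S[OF a(2) Es] a(2)] saturation_eq_iff[OF D(3) S[OF Es a(2)] a(2)]
      by simp_all
  qed
  show "U \<lhd>\<lhd>\<^bsub>X\<^esub> U \<odot>\<^bsub>X\<^esub> E"
  proof (rule coversI)
    fix a assume a: "a \<in> U"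
    have "{a} \<odot>\<^bsub>X\<^esub> E \<subseteq> U \<odot>\<^bsub>X\<^esub> E" by (intro pointwise_conv_mono D(1) U Es) (use a in auto)
    from covers_subset[OF D(3) S[OF U Es] this] coversD[OF unit(1)[OF a], of a]
    show "a \<lhd>\<^bsub>X\<^esub> U \<odot>\<^bsub>X\<^esub> E" using cov_trans[OF D(3) S[OF U Es]] by simp
  qed
  show "E \<odot>\<^bsub>X\<^esub> U \<lhd>\<lhd>\<^bsub>X\<^esub> U"
  proof (rule conv_covers_pointwise[OF D(1) Es U])
    fix e a assume ea: "e \<in> E" "a \<in> U"
    have a: "{a} \<subseteq> pts X" using ea U by auto
    have "{e} \<odot>\<^bsub>X\<^esub> {a} \<subseteq> E \<odot>\<^bsub>X\<^esub> {a}" by (intro pointwise_conv_mono D(1) a Es) (use ea in auto)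
    then have 1: "{e} \<odot>\<^bsub>X\<^esub> {a} \<lhd>\<lhd>\<^bsub>X\<^esub> E \<odot>\<^bsub>X\<^esub> {a}" by (intro covers_subset D(3) S Es a)
    have 2: "{a} \<lhd>\<lhd>\<^bsub>X\<^esub> U" using ea by (intro covers_subset D(3) U) simp
    show "{e} \<odot>\<^bsub>X\<^esub> {a} \<lhd>\<lhd>\<^bsub>X\<^esub> U"
      by (rule covers_trans[OF D(3) U 1 covers_trans[OF D(3) U unit(2)[OF ea(2)] 2]])
  qed
qed

text \<open>The usual argument in a monoid: \<open>E = E \<odot> F = F\<close>, up to saturation.\<close>

lemma unit_unique:
  assumes X: "pointwise_convergent X" and E: "is_unit X E" and F: "is_unit X F"
  shows "saturation X E = saturation X F"
proof -
  note bc = pointwise_convergentD(3)[OF X]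
  have s: "E \<subseteq> pts X" "F \<subseteq> pts X" using E F by (auto simp: is_unit_def)
  have "E \<lhd>\<lhd>\<^bsub>X\<^esub> F"
    by (rule covers_trans[OF bc s(2) unit_covers_conv(1)[OF X F s(1)] unit_covers_conv(2)[OF X E s(2)]])
  moreover have "F \<lhd>\<lhd>\<^bsub>X\<^esub> E"
    by (rule covers_trans[OF bc s(1) unit_covers_conv(1)[OF X E s(2)] unit_covers_conv(2)[OF X F s(1)]])
  ultimately show ?thesis using saturation_eq_iff[OF bc s] by simp
qed

lemma formal_is_unit:
  assumes "pointwise X" "formal_cover X"
  shows "is_unit X (pts X)"
proof -
  have "saturation X ({a} \<odot>\<^bsub>X\<^esub> pts X) = saturation X {a} \<inter> saturation X (pts X)"
    "saturation X (pts X \<odot>\<^bsub>X\<^esub> {a}) = saturation X (pts X) \<inter> saturation X {a}" if "a \<in> pts X" for a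
    using assms(2) that by (auto simp: formal_cover_def)
  moreover have "saturation X (pts X) = pts X"
    using assms(2) by (auto simp: formal_cover_def convergent_cover_def saturation_def intro: cov_refl)
  moreover have "saturation X {a} \<subseteq> pts X" for a by (rule saturation_subset)
  ultimately show ?thesis by (simp add: is_unit_def Int_absorb1 Int_absorb2)
qed

lemma preimage_subset: "basic_cover_map X Y r \<Longrightarrow> r\<inverse> `` V \<subseteq> pts X"
  by (auto simp: basic_cover_map_def)

lemma preimage_covers:
  assumes "basic_cover X" "basic_cover_map X Y r" "U \<lhd>\<lhd>\<^bsub>Y\<^esub> V"
  shows "r\<inverse> `` U \<lhd>\<lhd>\<^bsub>X\<^esub> r\<inverse> `` V"
proof (rule coversI)
  fix x assume "x \<in> r\<inverse> `` U"
  then obtain b where b: "b \<in> U" "x \<in> r\<inverse> `` {b}" by blast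
  have "b \<lhd>\<^bsub>Y\<^esub> V" using assms(3) b(1) by (rule coversD)
  then have "r\<inverse> `` {b} \<lhd>\<lhd>\<^bsub>X\<^esub> r\<inverse> `` V" using assms(2) by (simp add: basic_cover_map_def)
  then show "x \<lhd>\<^bsub>X\<^esub> r\<inverse> `` V" using b(2) by (rule coversD)
qed

lemma preimage_saturation_cong:
  assumes X: "basic_cover X" and Y: "basic_cover Y" and r: "basic_cover_map X Y r"
    and U: "U \<subseteq> pts Y" and V: "V \<subseteq> pts Y" and eq: "saturation Y U = saturation Y V"
  shows "saturation X (r\<inverse> `` U) = saturation X (r\<inverse> `` V)"
  using preimage_covers[OF X r, of U V] preimage_covers[OF X r, of V U] eq
    saturation_eq_iff[OF Y U V] saturation_eq_iff[OF X preimage_subset[OF r] preimage_subset[OF r]]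
  by simp

lemma preimage_pointwise_cong:
  assumes X: "basic_cover X" and r: "r \<subseteq> pts X \<times> pts Y" and s: "s \<subseteq> pts X \<times> pts Y"
    and eq: "\<And>b. b \<in> pts Y \<Longrightarrow> saturation X (r\<inverse> `` {b}) = saturation X (s\<inverse> `` {b})"
  shows "saturation X (r\<inverse> `` V) = saturation X (s\<inverse> `` V)"
proof -
  have *: "r\<inverse> `` V \<lhd>\<lhd>\<^bsub>X\<^esub> s\<inverse> `` V"
    if r: "r \<subseteq> pts X \<times> pts Y" and s: "s \<subseteq> pts X \<times> pts Y"
      and eq: "\<And>b. b \<in> pts Y \<Longrightarrow> saturation X (r\<inverse> `` {b}) = saturation X (s\<inverse> `` {b})" for r s
  proof (rule coversI)
    fix x assume "x \<in> r\<inverse> `` V"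
    then obtain b where b: "b \<in> V" "b \<in> pts Y" "x \<in> r\<inverse> `` {b}" using r by blast
    have sub: "r\<inverse> `` {b} \<subseteq> pts X" "s\<inverse> `` {b} \<subseteq> pts X" "s\<inverse> `` V \<subseteq> pts X" using r s by auto
    have "r\<inverse> `` {b} \<lhd>\<lhd>\<^bsub>X\<^esub> s\<inverse> `` {b}"
      using eq[OF b(2)] saturation_eq_iff[OF X sub(1,2)] by simp
    moreover have "s\<inverse> `` {b} \<lhd>\<lhd>\<^bsub>X\<^esub> s\<inverse> `` V"
      by (rule covers_subset[OF X sub(3)]) (use b in blast)
    ultimately have "r\<inverse> `` {b} \<lhd>\<lhd>\<^bsub>X\<^esub> s\<inverse> `` V" by (rule covers_trans[OF X sub(3)])
    then show "x \<lhd>\<^bsub>X\<^esub> s\<inverse> `` V" using b(3) by (rule coversD)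
  qed
  have "r\<inverse> `` V \<subseteq> pts X" "s\<inverse> `` V \<subseteq> pts X" using r s by auto
  from saturation_eq_iff[OF X this] show ?thesis using *[OF r s eq] *[OF s r eq[symmetric]] by simp
qed

lemma unital_conv_mapD:
  assumes "unital_conv_map X Y r"
  shows "basic_cover_map X Y r" "r \<subseteq> pts X \<times> pts Y"
    and "b \<in> pts Y \<Longrightarrow> c \<in> pts Y \<Longrightarrow>
      saturation X (r\<inverse> `` ({b} \<odot>\<^bsub>Y\<^esub> {c})) = saturation X ((r\<inverse> `` {b}) \<odot>\<^bsub>X\<^esub> (r\<inverse> `` {c}))"
    and "is_unit X E \<Longrightarrow> is_unit Y E' \<Longrightarrow> saturation X (r\<inverse> `` E') = saturation X E"
  using assms by (simp_all add: unital_conv_map_def basic_cover_map_def)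

lemma preimage_conv:
  assumes X: "pointwise_convergent X" and Y: "pointwise Y" and r: "unital_conv_map X Y r"
    and U: "U \<subseteq> pts Y" and V: "V \<subseteq> pts Y"
  shows "saturation X (r\<inverse> `` (U \<odot>\<^bsub>Y\<^esub> V)) = saturation X ((r\<inverse> `` U) \<odot>\<^bsub>X\<^esub> (r\<inverse> `` V))"
proof -
  note D = pointwise_convergentD[OF X] and S = pointwise_conv_subset[OF pointwise_convergentD(1)[OF X]]
  note pre = preimage_subset[OF unital_conv_mapD(1)[OF r]]
  have single: "r\<inverse> `` ({b} \<odot>\<^bsub>Y\<^esub> {c}) \<lhd>\<lhd>\<^bsub>X\<^esub> (r\<inverse> `` {b}) \<odot>\<^bsub>X\<^esub> (r\<inverse> `` {c})"
    "(r\<inverse> `` {b}) \<odot>\<^bsub>X\<^esub> (r\<inverse> `` {c}) \<lhd>\<lhd>\<^bsub>X\<^esub> r\<inverse> `` ({b} \<odot>\<^bsub>Y\<^esub> {c})"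
    if "b \<in> U" "c \<in> V" for b c
    using unital_conv_mapD(3)[OF r, of b c] that U V saturation_eq_iff[OF D(3) pre S[OF pre pre]] by auto
  have "r\<inverse> `` (U \<odot>\<^bsub>Y\<^esub> V) \<lhd>\<lhd>\<^bsub>X\<^esub> (r\<inverse> `` U) \<odot>\<^bsub>X\<^esub> (r\<inverse> `` V)"
  proof (rule coversI)
    fix x assume "x \<in> r\<inverse> `` (U \<odot>\<^bsub>Y\<^esub> V)"
    then obtain y where y: "(x, y) \<in> r" "y \<in> U \<odot>\<^bsub>Y\<^esub> V" by blast
    have "\<exists>b\<in>U. \<exists>c\<in>V. y \<in> {b} \<odot>\<^bsub>Y\<^esub> {c}"
      using y(2) by (simp only: pointwise_conv_iff[OF Y U V])
    then obtain b c where bc: "b \<in> U" "c \<in> V" "y \<in> {b} \<odot>\<^bsub>Y\<^esub> {c}" by blast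
    then have "x \<in> r\<inverse> `` ({b} \<odot>\<^bsub>Y\<^esub> {c})" using y(1) by blast
    with single(1)[OF bc(1,2)] have "x \<lhd>\<^bsub>X\<^esub> (r\<inverse> `` {b}) \<odot>\<^bsub>X\<^esub> (r\<inverse> `` {c})" by (rule coversD)
    moreover have "(r\<inverse> `` {b}) \<odot>\<^bsub>X\<^esub> (r\<inverse> `` {c}) \<subseteq> (r\<inverse> `` U) \<odot>\<^bsub>X\<^esub> (r\<inverse> `` V)"
      by (rule pointwise_conv_mono[OF D(1) _ _ pre pre]) (use bc in blast)+
    ultimately show "x \<lhd>\<^bsub>X\<^esub> (r\<inverse> `` U) \<odot>\<^bsub>X\<^esub> (r\<inverse> `` V)"
      using cov_trans[OF D(3) S[OF pre pre]] covers_subset[OF D(3) S[OF pre pre]] by blast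
  qed
  moreover have "(r\<inverse> `` U) \<odot>\<^bsub>X\<^esub> (r\<inverse> `` V) \<lhd>\<lhd>\<^bsub>X\<^esub> r\<inverse> `` (U \<odot>\<^bsub>Y\<^esub> V)"
  proof (rule conv_covers_pointwise[OF D(1) pre pre])
    fix p q assume "p \<in> r\<inverse> `` U" "q \<in> r\<inverse> `` V"
    then obtain b c where bc: "b \<in> U" "c \<in> V" "(p, b) \<in> r" "(q, c) \<in> r" by blast
    have "{p} \<odot>\<^bsub>X\<^esub> {q} \<subseteq> (r\<inverse> `` {b}) \<odot>\<^bsub>X\<^esub> (r\<inverse> `` {c})"
      by (rule pointwise_conv_mono[OF D(1) _ _ pre pre]) (use bc in blast)+
    then have 1: "{p} \<odot>\<^bsub>X\<^esub> {q} \<lhd>\<lhd>\<^bsub>X\<^esub> (r\<inverse> `` {b}) \<odot>\<^bsub>X\<^esub> (r\<inverse> `` {c})"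
      by (intro covers_subset D(3) S pre)
    have "{b} \<odot>\<^bsub>Y\<^esub> {c} \<subseteq> U \<odot>\<^bsub>Y\<^esub> V"
      by (rule pointwise_conv_mono[OF Y _ _ U V]) (use bc in blast)+
    then have 2: "r\<inverse> `` ({b} \<odot>\<^bsub>Y\<^esub> {c}) \<lhd>\<lhd>\<^bsub>X\<^esub> r\<inverse> `` (U \<odot>\<^bsub>Y\<^esub> V)"
      by (intro covers_subset D(3) pre Image_mono order_refl)
    show "{p} \<odot>\<^bsub>X\<^esub> {q} \<lhd>\<lhd>\<^bsub>X\<^esub> r\<inverse> `` (U \<odot>\<^bsub>Y\<^esub> V)"
      by (rule covers_trans[OF D(3) pre 1 covers_trans[OF D(3) pre single(2)[OF bc(1,2)] 2]])
  qed
  ultimately show ?thesis using saturation_eq_iff[OF D(3) pre S[OF pre pre]] by simp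
qed

lemma preimage_relcomp: "(r O s)\<inverse> `` V = r\<inverse> `` (s\<inverse> `` V)"
  by blast

text \<open>
  A unit in the middle cover is needed for the composite to preserve units: the two unit
  conditions can only be chained through one.
\<close>

lemma unital_conv_map_relcomp:
  assumes X: "pointwise_convergent X" and Y: "pointwise_convergent Y" and Z: "pointwise Z"
    and "unital Y"
    and r: "unital_conv_map X Y r" and s: "unital_conv_map Y Z s"
  shows "unital_conv_map X Z (r O s)"
proof -
  note rD = unital_conv_mapD[OF r] and sD = unital_conv_mapD[OF s]
  note bX = pointwise_convergentD(3)[OF X] and bY = pointwise_convergentD(3)[OF Y]
  have "basic_cover_map X Z (r O s)"
    unfolding basic_cover_map_def preimage_relcomp
  proof (intro conjI allI impI)
    show "r O s \<subseteq> pts X \<times> pts Z" using rD(2) sD(2) by blast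
    fix b V assume "b \<lhd>\<^bsub>Z\<^esub> V"
    then show "r\<inverse> `` (s\<inverse> `` {b}) \<lhd>\<lhd>\<^bsub>X\<^esub> r\<inverse> `` (s\<inverse> `` V)"
      using sD(1) by (intro preimage_covers[OF bX rD(1)]) (simp add: basic_cover_map_def)
  qed
  moreover have "saturation X (r\<inverse> `` (s\<inverse> `` ({b} \<odot>\<^bsub>Z\<^esub> {c}))) =
      saturation X ((r\<inverse> `` (s\<inverse> `` {b})) \<odot>\<^bsub>X\<^esub> (r\<inverse> `` (s\<inverse> `` {c})))" if "b \<in> pts Z" "c \<in> pts Z" for b c
  proof -
    note pre = preimage_subset[OF sD(1)]
    have "saturation X (r\<inverse> `` (s\<inverse> `` ({b} \<odot>\<^bsub>Z\<^esub> {c}))) = saturation X (r\<inverse> `` ((s\<inverse> `` {b}) \<odot>\<^bsub>Y\<^esub> (s\<inverse> `` {c})))"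
      by (rule preimage_saturation_cong[OF bX bY rD(1) pre _ sD(3)[OF that]])
        (intro pointwise_conv_subset pointwise_convergentD(1) Y pre)
    also have "\<dots> = saturation X ((r\<inverse> `` (s\<inverse> `` {b})) \<odot>\<^bsub>X\<^esub> (r\<inverse> `` (s\<inverse> `` {c})))"
      by (rule preimage_conv[OF X pointwise_convergentD(1)[OF Y] r pre pre])
    finally show ?thesis .
  qed
  moreover have "saturation X (r\<inverse> `` (s\<inverse> `` G)) = saturation X E" if "is_unit X E" "is_unit Z G" for E G
  proof -
    obtain F where F: "is_unit Y F" using \<open>unital Y\<close> by (auto simp: unital_def)
    then have "saturation X (r\<inverse> `` (s\<inverse> `` G)) = saturation X (r\<inverse> `` F)"
      by (intro preimage_saturation_cong[OF bX bY rD(1) preimage_subset[OF sD(1)] _ sD(4)[OF F that(2)]])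
        (simp add: is_unit_def)
    also have "\<dots> = saturation X E" by (rule rD(4)[OF that(1) F])
    finally show ?thesis .
  qed
  ultimately show ?thesis by (simp add: unital_conv_map_def preimage_relcomp)
qed

lemma unital_conv_map_Id:
  assumes X: "pointwise_convergent X"
  shows "unital_conv_map X X (Id_on (pts X))"
proof -
  note D = pointwise_convergentD[OF X]
  have id: "(Id_on (pts X))\<inverse> `` V = V" if "V \<subseteq> pts X" for V using that by auto
  have "basic_cover_map X X (Id_on (pts X))"
    unfolding basic_cover_map_def
  proof (intro conjI allI impI)
    fix b V assume bV: "b \<lhd>\<^bsub>X\<^esub> V"
    then show "(Id_on (pts X))\<inverse> `` {b} \<lhd>\<lhd>\<^bsub>X\<^esub> (Id_on (pts X))\<inverse> `` V"
      using id[of "{b}"] id[of V] cov_pts[OF D(3) bV] by (simp add: covers_def)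
  qed auto
  moreover have "saturation X ((Id_on (pts X))\<inverse> `` ({b} \<odot>\<^bsub>X\<^esub> {c})) =
      saturation X (((Id_on (pts X))\<inverse> `` {b}) \<odot>\<^bsub>X\<^esub> ((Id_on (pts X))\<inverse> `` {c}))"
    if "b \<in> pts X" "c \<in> pts X" for b c
    using that id[of "{b}"] id[of "{c}"] id[OF pointwise_conv_subset[OF D(1), of "{b}" "{c}"]] by simp
  moreover have "saturation X ((Id_on (pts X))\<inverse> `` F) = saturation X E" if "is_unit X E" "is_unit X F" for E F
    using that(2) unit_unique[OF X that] id[of F] by (simp add: is_unit_def)
  ultimately show ?thesis unfolding unital_conv_map_def by blast
qed

section \<open>Categories of covers\<close>

lemma equiv_map_eq: "equiv {r. unital_conv_map X Y r} (map_eq X Y)"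
  by (rule equivI) (auto simp: map_eq_def refl_on_def sym_def trans_def)

lemma map_eq_relcomp:
  assumes X: "pointwise_convergent X" and Y: "pointwise_convergent Y" and Z: "pointwise Z" and "unital Y"
    and rr: "(r, r') \<in> map_eq X Y" and ss: "(s, s') \<in> map_eq Y Z"
  shows "(r O s, r' O s') \<in> map_eq X Z"
proof -
  note bX = pointwise_convergentD(3)[OF X] and bY = pointwise_convergentD(3)[OF Y]
  have u: "unital_conv_map X Y r" "unital_conv_map X Y r'" "unital_conv_map Y Z s" "unital_conv_map Y Z s'"
    and req: "\<And>b. b \<in> pts Y \<Longrightarrow> saturation X (r\<inverse> `` {b}) = saturation X (r'\<inverse> `` {b})"
    and seq: "\<And>b. b \<in> pts Z \<Longrightarrow> saturation Y (s\<inverse> `` {b}) = saturation Y (s'\<inverse> `` {b})"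
    using rr ss by (auto simp: map_eq_def)
  have "saturation X (r\<inverse> `` (s\<inverse> `` {b})) = saturation X (r'\<inverse> `` (s'\<inverse> `` {b}))" if "b \<in> pts Z" for b
  proof -
    have "saturation X (r\<inverse> `` (s\<inverse> `` {b})) = saturation X (r\<inverse> `` (s'\<inverse> `` {b}))"
      by (rule preimage_saturation_cong[OF bX bY unital_conv_mapD(1)[OF u(1)]
          preimage_subset[OF unital_conv_mapD(1)[OF u(3)]] preimage_subset[OF unital_conv_mapD(1)[OF u(4)]]
          seq[OF that]])
    also have "\<dots> = saturation X (r'\<inverse> `` (s'\<inverse> `` {b}))"
      by (rule preimage_pointwise_cong[OF bX unital_conv_mapD(2)[OF u(1)] unital_conv_mapD(2)[OF u(2)] req])
    finally show ?thesis .
  qed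
  then show ?thesis
    using unital_conv_map_relcomp[OF X Y Z \<open>unital Y\<close>] u by (simp add: map_eq_def preimage_relcomp)
qed

lemma HomE:
  assumes "f \<in> Hom (cover_category \<O>) X Y"
  obtains r where "unital_conv_map X Y r" "f = map_eq X Y `` {r}"
  using assms by (auto simp: cover_category_def elim: quotientE)

lemma HomI: "unital_conv_map X Y r \<Longrightarrow> map_eq X Y `` {r} \<in> Hom (cover_category \<O>) X Y"
  by (simp add: cover_category_def quotientI)

text \<open>
  Composition of classes is defined by collecting all composites of representatives. As relational
  composition respects equality of maps, these composites form part of a single class.
\<close>

lemma cmp_class:
  assumes "pointwise_convergent X" "pointwise_convergent Y" "pointwise Z" "unital Y"
    and r: "unital_conv_map X Y r" and s: "unital_conv_map Y Z s"
  shows "cmp (cover_category \<O>) X Y Z (map_eq Y Z `` {s}) (map_eq X Y `` {r}) = map_eq X Z `` {r O s}"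
proof -
  have self: "(r, r) \<in> map_eq X Y" "(s, s) \<in> map_eq Y Z" using r s by (auto simp: map_eq_def)
  have "map_eq X Z `` {r' O s'} = map_eq X Z `` {r O s}"
    if "(r, r') \<in> map_eq X Y" "(s, s') \<in> map_eq Y Z" for r' s'
    using equiv_class_eq[OF equiv_map_eq map_eq_relcomp[OF assms(1-4) that]] by simp
  then have "map_eq X Z `` {r' O s' |r' s'. (r, r') \<in> map_eq X Y \<and> (s, s') \<in> map_eq Y Z} = map_eq X Z `` {r O s}"
    using self by (subst Image_eq_UN) blast
  then show ?thesis by (simp add: cover_category_def)
qed

lemma category_cover_category:
  assumes \<O>: "\<And>X. X \<in> \<O> \<Longrightarrow> pointwise_convergent X \<and> unital X"
  shows "category (cover_category \<O>)"
proof -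
  have Ob: "pointwise_convergent X" "pointwise X" "unital X" if "X \<in> Ob (cover_category \<O>)" for X
    using \<O>[of X] that by (auto simp: cover_category_def pointwise_convergentD)
  have idt: "idt (cover_category \<O>) X = map_eq X X `` {Id_on (pts X)}" for X
    by (simp add: cover_category_def)
  show ?thesis
  proof
    fix X assume "X \<in> Ob (cover_category \<O>)"
    then show "idt (cover_category \<O>) X \<in> Hom (cover_category \<O>) X X"
      unfolding idt by (intro HomI unital_conv_map_Id Ob)
  next
    fix X Y Z f g
    assume X: "X \<in> Ob (cover_category \<O>)" and Y: "Y \<in> Ob (cover_category \<O>)" and Z: "Z \<in> Ob (cover_category \<O>)"
      and f: "f \<in> Hom (cover_category \<O>) X Y" and g: "g \<in> Hom (cover_category \<O>) Y Z"
    obtain r where r: "unital_conv_map X Y r" "f = map_eq X Y `` {r}" using f by (rule HomE)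
    obtain s where s: "unital_conv_map Y Z s" "g = map_eq Y Z `` {s}" using g by (rule HomE)
    note XYZ = Ob(1)[OF X] Ob(1)[OF Y] Ob(2)[OF Z] Ob(3)[OF Y]
    show "cmp (cover_category \<O>) X Y Z g f \<in> Hom (cover_category \<O>) X Z"
      unfolding r(2) s(2) cmp_class[OF XYZ r(1) s(1)]
      by (rule HomI[OF unital_conv_map_relcomp[OF XYZ r(1) s(1)]])
  next
    fix X Y f
    assume X: "X \<in> Ob (cover_category \<O>)" and Y: "Y \<in> Ob (cover_category \<O>)"
      and f: "f \<in> Hom (cover_category \<O>) X Y"
    obtain r where r: "unital_conv_map X Y r" "f = map_eq X Y `` {r}" using f by (rule HomE)
    have "Id_on (pts X) O r = r" "r O Id_on (pts Y) = r" using unital_conv_mapD(2)[OF r(1)] by auto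
    then show "cmp (cover_category \<O>) X X Y f (idt (cover_category \<O>) X) = f"
      and "cmp (cover_category \<O>) X Y Y (idt (cover_category \<O>) Y) f = f"
      unfolding idt r(2)
      using cmp_class[OF Ob(1)[OF X] Ob(1)[OF X] Ob(2)[OF Y] Ob(3)[OF X] unital_conv_map_Id[OF Ob(1)[OF X]] r(1), of \<O>]
        cmp_class[OF Ob(1)[OF X] Ob(1)[OF Y] Ob(2)[OF Y] Ob(3)[OF Y] r(1) unital_conv_map_Id[OF Ob(1)[OF Y]], of \<O>]
      by simp_all
  next
    fix W X Y Z f g h
    assume W: "W \<in> Ob (cover_category \<O>)" and X: "X \<in> Ob (cover_category \<O>)" and Y: "Y \<in> Ob (cover_category \<O>)"
      and Z: "Z \<in> Ob (cover_category \<O>)"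
      and f: "f \<in> Hom (cover_category \<O>) W X" and g: "g \<in> Hom (cover_category \<O>) X Y" and h: "h \<in> Hom (cover_category \<O>) Y Z"
    obtain r where r: "unital_conv_map W X r" "f = map_eq W X `` {r}" using f by (rule HomE)
    obtain s where s: "unital_conv_map X Y s" "g = map_eq X Y `` {s}" using g by (rule HomE)
    obtain t where t: "unital_conv_map Y Z t" "h = map_eq Y Z `` {t}" using h by (rule HomE)
    note WXY = Ob(1)[OF W] Ob(1)[OF X] Ob(2)[OF Y] Ob(3)[OF X]
      and XYZ = Ob(1)[OF X] Ob(1)[OF Y] Ob(2)[OF Z] Ob(3)[OF Y]
      and WYZ = Ob(1)[OF W] Ob(1)[OF Y] Ob(2)[OF Z] Ob(3)[OF Y]
      and WXZ = Ob(1)[OF W] Ob(1)[OF X] Ob(2)[OF Z] Ob(3)[OF X]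
    show "cmp (cover_category \<O>) W X Z (cmp (cover_category \<O>) X Y Z h g) f =
        cmp (cover_category \<O>) W Y Z h (cmp (cover_category \<O>) W X Y g f)"
      unfolding r(2) s(2) t(2) cmp_class[OF XYZ s(1) t(1)] cmp_class[OF WXY r(1) s(1)]
        cmp_class[OF WYZ unital_conv_map_relcomp[OF WXY r(1) s(1)] t(1)]
        cmp_class[OF WXZ r(1) unital_conv_map_relcomp[OF XYZ s(1) t(1)]]
      by (simp add: O_assoc)
  qed
qed

section \<open>The adjunction\<close>

lemma saturation_formalize_cong:
  assumes X: "pointwise_convergent X" and U: "U \<subseteq> pts X" and V: "V \<subseteq> pts X"
    and eq: "saturation X U = saturation X V"
  shows "saturation (formalize X) U = saturation (formalize X) V"
proof -
  have "U \<lhd>\<lhd>\<^bsub>X\<^esub> V" "V \<lhd>\<lhd>\<^bsub>X\<^esub> U"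
    using eq saturation_eq_iff[OF pointwise_convergentD(3)[OF X] U V] by simp_all
  then have "U \<lhd>\<lhd>\<^bsub>formalize X\<^esub> V" "V \<lhd>\<lhd>\<^bsub>formalize X\<^esub> U"
    using U V by (simp_all add: covers_formalize)
  then show ?thesis
    using saturation_eq_iff[OF basic_cover_formalize[OF X]] U V by simp
qed

lemma is_unit_formalize:
  assumes X: "pointwise_convergent X" and E: "is_unit X E"
  shows "is_unit (formalize X) E"
proof -
  have Es: "E \<subseteq> pts X" using E by (simp add: is_unit_def)
  have "saturation (formalize X) ({a} \<odot>\<^bsub>X\<^esub> E) = saturation (formalize X) {a}"
    "saturation (formalize X) {a} = saturation (formalize X) (E \<odot>\<^bsub>X\<^esub> {a})" if "a \<in> pts X" for a
    using E that Es pointwise_conv_subset[OF pointwise_convergentD(1)[OF X]]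
    by (intro saturation_formalize_cong[OF X]; simp add: is_unit_def)+
  then show ?thesis using Es by (simp add: is_unit_def)
qed

lemma formalize_formal_cover:
  assumes "pointwise_convergent X"
  shows "pointwise_convergent (formalize X)" "pointwise (formalize X)" "unital (formalize X)"
  using assms formal_cover_formalize[OF assms] formal_is_unit[of "formalize X"]
  by (auto simp: pointwise_convergent_def formal_cover_def unital_def)

text \<open>
  The universal property of the enlarged relation: inverse image preserves the operation up to
  saturation, so it carries weakening and contraction in \<open>Y\<close> to instances of weakening and
  contraction in \<open>X\<close>, where they hold because \<open>X\<close> is formal.
\<close>

lemma preimage_formal_covers:
  assumes X: "pointwise X" "formal_cover X" and Y: "pointwise_convergent Y" and r: "unital_conv_map X Y r"
    and "formal_cov Y b V"
  shows "r\<inverse> `` {b} \<lhd>\<lhd>\<^bsub>X\<^esub> r\<inverse> `` V"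
  using assms(5)
proof induction
  have pX: "pointwise_convergent X" using X by (simp add: pointwise_convergent_def formal_cover_def)
  note bX = pointwise_convergentD(3)[OF pX]
  note rD = unital_conv_mapD[OF r]
  note pre = preimage_subset[OF rD(1)]
  note S = pointwise_conv_subset[OF X(1)]
  note conv_iff = saturation_eq_iff[OF bX pre S[OF pre pre]]
  {
    case (refl b V)
    then show ?case by (intro covers_subset bX pre) blast
  next
    case (cov b W V)
    have "r\<inverse> `` {b} \<lhd>\<lhd>\<^bsub>X\<^esub> r\<inverse> `` W" using rD(1) cov(1) by (simp add: basic_cover_map_def)
    moreover have "r\<inverse> `` W \<lhd>\<lhd>\<^bsub>X\<^esub> r\<inverse> `` V"
      by (rule coversI) (use cov(4) coversD in fastforce)
    ultimately show ?case by (rule covers_trans[OF bX pre])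
  next
    case (weakening c d b V)
    have 1: "r\<inverse> `` {b} \<lhd>\<lhd>\<^bsub>X\<^esub> r\<inverse> `` ({c} \<odot>\<^bsub>Y\<^esub> {d})"
      by (rule covers_subset[OF bX pre]) (use weakening(3) in blast)
    have 2: "r\<inverse> `` ({c} \<odot>\<^bsub>Y\<^esub> {d}) \<lhd>\<lhd>\<^bsub>X\<^esub> (r\<inverse> `` {c}) \<odot>\<^bsub>X\<^esub> (r\<inverse> `` {d})"
      using rD(3)[OF weakening(1,2)] conv_iff by simp
    have 3: "(r\<inverse> `` {c}) \<odot>\<^bsub>X\<^esub> (r\<inverse> `` {d}) \<lhd>\<lhd>\<^bsub>X\<^esub> r\<inverse> `` {d}"
      by (rule formal_weakening[OF X(2) pre pre])
    note T = covers_trans[OF bX]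
    show ?case by (rule T[OF pre 1 T[OF pre 2 T[OF pre 3 weakening(5)]]])
  next
    case (contraction b V)
    have 1: "r\<inverse> `` {b} \<lhd>\<lhd>\<^bsub>X\<^esub> (r\<inverse> `` {b}) \<odot>\<^bsub>X\<^esub> (r\<inverse> `` {b})"
      by (rule formal_contraction[OF X(2) pre])
    have 2: "(r\<inverse> `` {b}) \<odot>\<^bsub>X\<^esub> (r\<inverse> `` {b}) \<lhd>\<lhd>\<^bsub>X\<^esub> r\<inverse> `` ({b} \<odot>\<^bsub>Y\<^esub> {b})"
      using rD(3)[OF contraction(1,1)] conv_iff by simp
    have 3: "r\<inverse> `` ({b} \<odot>\<^bsub>Y\<^esub> {b}) \<lhd>\<lhd>\<^bsub>X\<^esub> r\<inverse> `` V"
      by (rule coversI) (use contraction(4) coversD in fastforce)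
    note T = covers_trans[OF bX]
    show ?case by (rule T[OF pre 1 T[OF pre 2 3]])
  }
qed

text \<open>
  The condition on units is the delicate point, since \<open>formalize Y\<close> may have more units than \<open>Y\<close>.
  All of them have the same saturation there as a unit of \<open>Y\<close>, by uniqueness of units.
\<close>

lemma unital_conv_map_formalize_iff:
  assumes X: "pointwise X" "formal_cover X" and Y: "pointwise_convergent Y" "unital Y"
  shows "unital_conv_map X (formalize Y) r \<longleftrightarrow> unital_conv_map X Y r"
proof
  have pX: "pointwise_convergent X" using X by (simp add: pointwise_convergent_def formal_cover_def)
  note bX = pointwise_convergentD(3)[OF pX]
  note LY = formalize_formal_cover[OF Y(1)]
  {
    assume r: "unital_conv_map X (formalize Y) r"
    have "b \<lhd>\<^bsub>formalize Y\<^esub> V" if "b \<lhd>\<^bsub>Y\<^esub> V" for b V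
      using covers_formalize[of Y "{b}" V] that cov_pts[OF pointwise_convergentD(3)[OF Y(1)] that]
      by (simp add: covers_def)
    with r show "unital_conv_map X Y r"
      using is_unit_formalize[OF Y(1)] by (simp add: unital_conv_map_def basic_cover_map_def)
  next
    assume r: "unital_conv_map X Y r"
    have bm: "basic_cover_map X (formalize Y) r"
      using unital_conv_mapD(2)[OF r] preimage_formal_covers[OF X Y(1) r] by (simp add: basic_cover_map_def)
    have "saturation X (r\<inverse> `` F) = saturation X E" if "is_unit X E" "is_unit (formalize Y) F" for E F
    proof -
      obtain G where G: "is_unit Y G" using Y(2) by (auto simp: unital_def)
      note LG = is_unit_formalize[OF Y(1) G]
      have "saturation X (r\<inverse> `` F) = saturation X (r\<inverse> `` G)"
        using that(2) LG
        by (intro preimage_saturation_cong[OF bX pointwise_convergentD(3)[OF LY(1)] bm _ _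
            unit_unique[OF LY(1) that(2) LG]]) (simp_all add: is_unit_def)
      also have "\<dots> = saturation X E" by (rule unital_conv_mapD(4)[OF r that(1) G])
      finally show ?thesis .
    qed
    then show "unital_conv_map X (formalize Y) r"
      using bm r by (simp add: unital_conv_map_def)
  }
qed

lemma map_eq_formalize:
  assumes "pointwise X" "formal_cover X" "pointwise_convergent Y" "unital Y"
  shows "map_eq X (formalize Y) = map_eq X Y"
  by (simp add: map_eq_def unital_conv_map_formalize_iff[OF assms])

text \<open>
  The component of the counit at \<open>Y\<close>. Composing with it turns a map \<open>Y \<rightarrow> Z\<close> into a map
  \<open>formalize Y \<rightarrow> Z\<close> given by the same relation, so that the previous results on maps out of a
  formal cover become applicable.
\<close>

lemma counit_formalize:
  assumes Y: "pointwise_convergent Y" "unital Y"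
  shows "unital_conv_map (formalize Y) Y (Id_on (pts Y))"
  using unital_conv_map_formalize_iff[OF formalize_formal_cover(2)[OF Y(1)] formal_cover_formalize[OF Y(1)] Y]
    unital_conv_map_Id[OF formalize_formal_cover(1)[OF Y(1)]] by simp

lemma map_eq_formalize_mono:
  assumes Y: "pointwise_convergent Y" "unital Y" and Z: "pointwise_convergent Z" "unital Z"
    and rs: "(r, s) \<in> map_eq Y Z"
  shows "(r, s) \<in> map_eq (formalize Y) (formalize Z)"
proof -
  let ?i = "Id_on (pts Y)"
  have "(?i, ?i) \<in> map_eq (formalize Y) Y" using counit_formalize[OF Y] by (simp add: map_eq_def)
  from map_eq_relcomp[OF formalize_formal_cover(1)[OF Y(1)] Y(1) pointwise_convergentD(1)[OF Z(1)] Y(2) this rs]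
  have "(?i O r, ?i O s) \<in> map_eq (formalize Y) Z" .
  moreover have "?i O r = r" "?i O s = s"
    using rs by (auto simp: map_eq_def dest: unital_conv_mapD(2))
  ultimately show ?thesis
    using map_eq_formalize[OF formalize_formal_cover(2)[OF Y(1)] formal_cover_formalize[OF Y(1)] Z] by simp
qed

text \<open>
  On representatives the functor acts as the identity. The class of a map has to be enlarged,
  because equality of maps out of \<open>formalize Y\<close> is coarser than equality of maps out of \<open>Y\<close>.
\<close>

definition formalization ::
    "('a conv_cover_str, 'a rel set, 'a conv_cover_str, 'a rel set) functor_str" where
  "formalization = \<lparr>on_ob = formalize, on_hom = (\<lambda>Y Z f. map_eq (formalize Y) (formalize Z) `` f)\<rparr>"

lemma formalization_class:
  assumes Y: "pointwise_convergent Y" "unital Y" and Z: "pointwise_convergent Z" "unital Z"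
    and r: "unital_conv_map Y Z r"
  shows "unital_conv_map (formalize Y) (formalize Z) r"
    and "on_hom formalization Y Z (map_eq Y Z `` {r}) = map_eq (formalize Y) (formalize Z) `` {r}"
proof -
  note L = map_eq_formalize_mono[OF Y Z]
  have rr: "(r, r) \<in> map_eq Y Z" using r by (simp add: map_eq_def)
  from L[OF this] show "unital_conv_map (formalize Y) (formalize Z) r" by (simp add: map_eq_def)
  have "map_eq (formalize Y) (formalize Z) `` {s} = map_eq (formalize Y) (formalize Z) `` {r}"
    if "(r, s) \<in> map_eq Y Z" for s
    using equiv_class_eq[OF equiv_map_eq L[OF that]] by simp
  then show "on_hom formalization Y Z (map_eq Y Z `` {r}) = map_eq (formalize Y) (formalize Z) `` {r}"
    using rr unfolding formalization_def functor_str.simps by (subst Image_eq_UN) blast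
qed

lemma Ob_uCBCov: "X \<in> Ob uCBCov \<longleftrightarrow> pointwise_convergent X \<and> unital X"
  by (simp add: uCBCov_def cover_category_def ind_gen_convergent_iff)

lemma Ob_FCov: "X \<in> Ob FCov \<longleftrightarrow> pointwise X \<and> formal_cover X"
  by (simp add: FCov_def cover_category_def ind_gen_formal_iff)

lemma Ob_FCov_uCBCov: "X \<in> Ob FCov \<Longrightarrow> X \<in> Ob uCBCov"
  using formal_is_unit by (auto simp: Ob_FCov Ob_uCBCov pointwise_convergent_def formal_cover_def unital_def)

text \<open>Both categories use the same maps; only their objects differ.\<close>

lemma same_structure:
  "Hom FCov = Hom uCBCov" "idt FCov = idt uCBCov" "cmp FCov = cmp uCBCov"
  by (simp_all add: FCov_def uCBCov_def cover_category_def)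

lemma category_uCBCov: "category uCBCov"
  unfolding uCBCov_def by (rule category_cover_category) (simp add: ind_gen_convergent_iff)

lemma category_FCov: "category FCov"
  unfolding FCov_def by (rule category_cover_category)
    (use Ob_FCov_uCBCov in \<open>simp add: Ob_FCov Ob_uCBCov ind_gen_formal_iff\<close>)

lemma uCBCov_HomE:
  assumes "f \<in> Hom uCBCov X Y"
  obtains r where "unital_conv_map X Y r" "f = map_eq X Y `` {r}"
  using assms unfolding uCBCov_def by (rule HomE)

lemma uCBCov_HomI: "unital_conv_map X Y r \<Longrightarrow> map_eq X Y `` {r} \<in> Hom uCBCov X Y"
  unfolding uCBCov_def by (rule HomI)

lemma uCBCov_cmp:
  assumes "X \<in> Ob uCBCov" "Y \<in> Ob uCBCov" "Z \<in> Ob uCBCov" "unital_conv_map X Y r" "unital_conv_map Y Z s"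
  shows "cmp uCBCov X Y Z (map_eq Y Z `` {s}) (map_eq X Y `` {r}) = map_eq X Z `` {r O s}"
    and "unital_conv_map X Z (r O s)"
proof -
  have *: "pointwise_convergent X" "pointwise_convergent Y" "pointwise Z" "unital Y"
    using assms(1-3) by (simp_all add: Ob_uCBCov pointwise_convergentD)
  show "cmp uCBCov X Y Z (map_eq Y Z `` {s}) (map_eq X Y `` {r}) = map_eq X Z `` {r O s}"
    unfolding uCBCov_def by (rule cmp_class[OF * assms(4,5)])
  show "unital_conv_map X Z (r O s)" by (rule unital_conv_map_relcomp[OF * assms(4,5)])
qed

lemma Hom_formalize:
  assumes "X \<in> Ob FCov" "Y \<in> Ob uCBCov"
  shows "Hom uCBCov X (formalize Y) = Hom uCBCov X Y"
proof -
  have *: "pointwise X" "formal_cover X" "pointwise_convergent Y" "unital Y"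
    using assms by (simp_all add: Ob_FCov Ob_uCBCov)
  have "unital_conv_map X (formalize Y) = unital_conv_map X Y"
    by (intro ext unital_conv_map_formalize_iff *)
  then show ?thesis
    by (simp add: uCBCov_def cover_category_def map_eq_formalize[OF *])
qed

lemma is_functor_forgetful: "is_functor FCov uCBCov forgetful"
  by (intro is_functor.intro is_functor_axioms.intro category_FCov category_uCBCov)
    (simp_all add: forgetful_def Ob_FCov_uCBCov same_structure)

lemma is_functor_formalization: "is_functor uCBCov FCov formalization"
proof (intro is_functor.intro is_functor_axioms.intro category_FCov category_uCBCov)
  have ob: "on_ob formalization X = formalize X" for X :: "'a conv_cover_str"
    by (simp add: formalization_def)
  note obD = Ob_uCBCov[THEN iffD1, THEN conjunct1] Ob_uCBCov[THEN iffD1, THEN conjunct2]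
  have L: "formalize X \<in> Ob FCov" if "X \<in> Ob uCBCov" for X :: "'a conv_cover_str"
    using that formalize_formal_cover(2) formal_cover_formalize by (auto simp: Ob_uCBCov Ob_FCov)
  note LC = Ob_FCov_uCBCov[OF L]
  fix X Y Z :: "'a conv_cover_str" and f g
  assume X: "X \<in> Ob uCBCov"
  then show "on_ob formalization X \<in> Ob FCov" unfolding ob by (rule L)
  have "Id_on (pts X) = Id_on (pts (formalize X))" by simp
  then show "on_hom formalization X X (idt uCBCov X) = idt FCov (on_ob formalization X)"
    using formalization_class(2)[OF obD[OF X] obD[OF X] unital_conv_map_Id[OF obD(1)[OF X]]]
    by (simp add: ob FCov_def uCBCov_def cover_category_def)
  assume Y: "Y \<in> Ob uCBCov" and f: "f \<in> Hom uCBCov X Y"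
  obtain r where r: "unital_conv_map X Y r" "f = map_eq X Y `` {r}" using f by (rule uCBCov_HomE)
  note Lr = formalization_class[OF obD[OF X] obD[OF Y] r(1)]
  show "on_hom formalization X Y f \<in> Hom FCov (on_ob formalization X) (on_ob formalization Y)"
    unfolding ob r(2) same_structure Lr(2) by (rule uCBCov_HomI[OF Lr(1)])
  assume Z: "Z \<in> Ob uCBCov" and g: "g \<in> Hom uCBCov Y Z"
  obtain s where s: "unital_conv_map Y Z s" "g = map_eq Y Z `` {s}" using g by (rule uCBCov_HomE)
  note Ls = formalization_class[OF obD[OF Y] obD[OF Z] s(1)]
  note rs = uCBCov_cmp[OF X Y Z r(1) s(1)]
  note Lrs = formalization_class[OF obD[OF X] obD[OF Z] rs(2)]
  show "on_hom formalization X Z (cmp uCBCov X Y Z g f) =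
      cmp FCov (on_ob formalization X) (on_ob formalization Y) (on_ob formalization Z)
        (on_hom formalization Y Z g) (on_hom formalization X Y f)"
    unfolding ob r(2) s(2) same_structure rs(1) Lr(2) Ls(2) Lrs(2)
    by (rule uCBCov_cmp(1)[OF LC[OF X] LC[OF Y] LC[OF Z] Lr(1) Ls(1), symmetric])
qed

lemma adjunction_formalization:
  "adjunction FCov uCBCov forgetful formalization (\<lambda>X Y f. f)"
proof (intro adjunction.intro adjunction_axioms.intro is_functor_forgetful is_functor_formalization)
  fix X Y :: "'a conv_cover_str"
  assume X: "X \<in> Ob FCov" and Y: "Y \<in> Ob uCBCov"
  then show "bij_betw (\<lambda>f. f) (Hom uCBCov (on_ob forgetful X) Y) (Hom FCov X (on_ob formalization Y))"
    using Hom_formalize[OF X Y] bij_betw_id[unfolded id_def]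
    by (simp add: forgetful_def formalization_def same_structure)
next
  fix X X' Y Y' :: "'a conv_cover_str" and f h k
  assume X: "X \<in> Ob FCov" and X': "X' \<in> Ob FCov" and Y: "Y \<in> Ob uCBCov" and Y': "Y' \<in> Ob uCBCov"
    and f: "f \<in> Hom FCov X' X" and h: "h \<in> Hom uCBCov (on_ob forgetful X) Y" and k: "k \<in> Hom uCBCov Y Y'"
  note obD = Ob_uCBCov[THEN iffD1, THEN conjunct1] Ob_uCBCov[THEN iffD1, THEN conjunct2]
  note C = Ob_FCov_uCBCov[OF X] Ob_FCov_uCBCov[OF X']
  have LY: "formalize Y \<in> Ob uCBCov" and LY': "formalize Y' \<in> Ob uCBCov"
    using formalize_formal_cover Y Y' by (auto simp: Ob_uCBCov)
  have h': "h \<in> Hom uCBCov X (formalize Y)"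
    using h Hom_formalize[OF X Y] by (simp add: forgetful_def)
  obtain r where r: "unital_conv_map X' X r" "f = map_eq X' X `` {r}"
    using f unfolding same_structure by (rule uCBCov_HomE)
  obtain s where Ls: "unital_conv_map X (formalize Y) s" "h = map_eq X (formalize Y) `` {s}"
    using h' by (rule uCBCov_HomE)
  obtain t where t: "unital_conv_map Y Y' t" "k = map_eq Y Y' `` {t}" using k by (rule uCBCov_HomE)
  note Lt = formalization_class[OF obD[OF Y] obD[OF Y'] t(1)]
  have FX: "pointwise X" "formal_cover X" and FX': "pointwise X'" "formal_cover X'"
    using X X' by (simp_all add: Ob_FCov)
  have s: "unital_conv_map X Y s" "h = map_eq X Y `` {s}"
    using Ls unital_conv_map_formalize_iff[OF FX obD[OF Y]] map_eq_formalize[OF FX obD[OF Y]] by simp_all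
  note rs = uCBCov_cmp[OF C(2,1) Y r(1) s(1)] and Lrs = uCBCov_cmp[OF C(2,1) LY r(1) Ls(1)]
  have "cmp uCBCov X' Y Y' k (cmp uCBCov X' X Y h f) = map_eq X' Y' `` {(r O s) O t}"
    using uCBCov_cmp(1)[OF C(2) Y Y' rs(2) t(1)] rs(1) by (simp add: r(2) s(2) t(2))
  also have "\<dots> = map_eq X' (formalize Y') `` {(r O s) O t}"
    using map_eq_formalize[OF FX' obD[OF Y']] by simp
  also have "\<dots> = cmp uCBCov X' (formalize Y) (formalize Y') (on_hom formalization Y Y' k)
      (cmp uCBCov X' X (formalize Y) h f)"
    using uCBCov_cmp(1)[OF C(2) LY LY' Lrs(2) Lt(1)] Lrs(1) by (simp add: r(2) Ls(2) t(2) Lt(2))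
  finally show "cmp uCBCov (on_ob forgetful X') Y Y' k
        (cmp uCBCov (on_ob forgetful X') (on_ob forgetful X) Y h (on_hom forgetful X' X f)) =
      cmp FCov X' (on_ob formalization Y) (on_ob formalization Y') (on_hom formalization Y Y' k)
        (cmp FCov X' X (on_ob formalization Y) h f)"
    by (simp add: forgetful_def same_structure formalization_def)
qed

theorem proposition7p5:
  "\<exists>L. is_right_adjoint (FCov :: ('a conv_cover_str, 'a rel set) cat) uCBCov forgetful L \<and>
       on_ob L ` Ob uCBCov = Ob FCov"
proof (intro exI conjI)
  show "is_right_adjoint (FCov :: ('a conv_cover_str, 'a rel set) cat) uCBCov forgetful formalization"
    unfolding is_right_adjoint_def using adjunction_formalization by blast
  show "on_ob formalization ` Ob uCBCov = Ob (FCov :: ('a conv_cover_str, 'a rel set) cat)"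
  proof
    show "on_ob formalization ` Ob uCBCov \<subseteq> Ob (FCov :: ('a conv_cover_str, 'a rel set) cat)"
      using is_functor.on_ob_in_Ob[OF is_functor_formalization] by blast
    show "Ob (FCov :: ('a conv_cover_str, 'a rel set) cat) \<subseteq> on_ob formalization ` Ob uCBCov"
    proof
      fix X :: "'a conv_cover_str" assume X: "X \<in> Ob FCov"
      then have "on_ob formalization X = X"
        by (simp add: formalization_def formalize_formal Ob_FCov)
      then show "X \<in> on_ob formalization ` Ob uCBCov" using Ob_FCov_uCBCov[OF X] by (metis image_eqI)
    qed
  qed
qed

end
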